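(* Let $D=\{u\in\mathbb{C}: |u|=1/\sqrt{3}\}\cup[-1,-1/3]\cup[1/3,1]$ and let $\Omega$ be the connected component of $\mathbb{C}\setminus D$ containing $0$. For $u\in\Omega$ let $$L(u)=\log\det{}_\pi\Delta_u=\frac{1}{(2\pi)^2}\int_0^{2\pi}\!\!\int_0^{2\pi}\log\bigl(1+3u^2-2u\cos t-2u\cos s\bigr)\,ds\,dt,$$ (principal branch of the logarithm; the argument avoids $(-\infty,0]$ for $u\in\Omega$, so $L$ is analytic on $\Omega$). Then for all $u\in\Omega\setminus\{0\}$, $$\frac{d}{du}L(u)=\frac{1}{u}-\frac{2}{\pi}\,\mathbf{K}(k)\,\frac{1}{k}\frac{dk}{du},\qquad k=\frac{4u}{1+3u^2},$$ where $\mathbf{K}$ is the principal branch of the complete elliptic integral of the first kind.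
   Context: The grid is the Cayley graph $X$ of $\pi=\mathbb{Z}\times\mathbb{Z}=\langle a\rangle\times\langle b\rangle$ with generators $\{a,b\}$ (4-regular). Its adjacency operator on $\ell^2(\mathbb{Z}^2)$ is $A=a+a^{-1}+b+b^{-1}$ and $\Delta_u=I-Au+3u^2$. The $\pi$-determinant is $\det_\pi\Delta_u=\exp(\mathrm{Tr}_\pi\,\mathrm{Log}\,\Delta_u)$, where $\mathrm{Tr}_\pi$ is the von Neumann trace (for a group ring element $\sum m_\gamma\gamma$ it equals the coefficient $m_e$ of the identity); via Fourier transform this equals the torus integral displayed in the claim. The complete elliptic integral of the first kind is $\mathbf{K}(k)=\int_0^{\pi/2}\frac{d\omega}{\sqrt{1-k^2\sin^2\omega}}$, whose principal branch is analytic on $\mathbb{C}\setminus((-\infty,-1]\cup[1,\infty))$; the map $u\mapsto k=4u/(1+3u^2)$ maps $\Omega$ homeomorphically onto this set. *)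

theory Defs
  imports "HOL-Complex_Analysis.Complex_Analysis"
begin

text \<open>
  Operators on the Hilbert space of square-summable functions on a set of type \<open>'a\<close> are
  total maps on \<open>'a \<Rightarrow> complex\<close>; only their restriction to \<open>l2\<close> is relevant.
\<close>

definition l2 :: "('a \<Rightarrow> complex) set" where
  "l2 = {f. (\<lambda>x. (cmod (f x))\<^sup>2) summable_on UNIV}"

definition l2norm :: "('a \<Rightarrow> complex) \<Rightarrow> real" where
  "l2norm f = sqrt (\<Sum>\<^sub>\<infinity>x. (cmod (f x))\<^sup>2)"

type_synonym 'a operator = "('a \<Rightarrow> complex) \<Rightarrow> ('a \<Rightarrow> complex)"

definition shifted :: "'a operator \<Rightarrow> complex \<Rightarrow> 'a operator" where
  "shifted T z = (\<lambda>f x. z * f x - T f x)"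

text \<open>The spectrum: \<open>z - T\<close> has no bounded two-sided inverse on \<open>l2\<close>.\<close>

definition spectrum_l2 :: "'a operator \<Rightarrow> complex set" where
  "spectrum_l2 T = {z. \<not> (bij_betw (shifted T z) l2 l2 \<and>
     (\<exists>C. \<forall>f\<in>l2. l2norm f \<le> C * l2norm (shifted T z f)))}"

definition resolvent_l2 :: "'a operator \<Rightarrow> complex \<Rightarrow> 'a operator" where
  "resolvent_l2 T z = inv_into l2 (shifted T z)"

text \<open>
  The principal logarithm of an operator whose spectrum avoids \<open>(-\<infinity>, 0]\<close>, by the
  holomorphic functional calculus
  \<open>Log T = 1/(2 \<pi> i) \<integral> Ln z (z - T)\<^sup>-\<^sup>1 dz\<close>
  over a contour in the slit plane that winds once around the spectrum. By Cauchy's theorem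
  the value does not depend on the contour, so an arbitrary one is chosen. The
  operator-valued integral is taken coordinatewise.
\<close>

definition log_contour :: "'a operator \<Rightarrow> (real \<Rightarrow> complex) \<Rightarrow> bool" where
  "log_contour T \<gamma> \<longleftrightarrow>
     valid_path \<gamma> \<and> pathfinish \<gamma> = pathstart \<gamma> \<and>
     path_image \<gamma> \<subseteq> - \<real>\<^sub>\<le>\<^sub>0 - spectrum_l2 T \<and>
     (\<forall>z\<in>spectrum_l2 T. winding_number \<gamma> z = 1) \<and>
     (\<forall>z\<in>\<real>\<^sub>\<le>\<^sub>0. winding_number \<gamma> z = 0)"

definition Log_op :: "'a operator \<Rightarrow> 'a operator" where
  "Log_op T = (\<lambda>f x. 1 / (2 * complex_of_real pi * \<i>) *
     contour_integral (SOME \<gamma>. log_contour T \<gamma>) (\<lambda>z. Ln z * resolvent_l2 T z f x))"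

text \<open>
  The von Neumann trace \<open>\<langle>T \<delta>, \<delta>\<rangle>\<close>, where \<open>\<delta>\<close> is the indicator of the identity of the group.
\<close>

definition delta_id :: "'a::group_add \<Rightarrow> complex" where
  "delta_id x = (if x = 0 then 1 else 0)"

definition Tr_vN :: "'a::group_add operator \<Rightarrow> complex" where
  "Tr_vN T = T delta_id 0"

definition det_vN :: "'a::group_add operator \<Rightarrow> complex" where
  "det_vN T = exp (Tr_vN (Log_op T))"

text \<open>
  The grid: \<open>a = (1, 0)\<close> and \<open>b = (0, 1)\<close> generate \<open>int \<times> int\<close>, and group elements act by
  translation.
\<close>

definition translate :: "'a::group_add \<Rightarrow> 'a operator" where
  "translate g = (\<lambda>f x. f (- g + x))"

definition adjacency :: "(int \<times> int) operator" where
  "adjacency = (\<lambda>f x. translate (1, 0) f x + translate (- 1, 0) f x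
                     + translate (0, 1) f x + translate (0, - 1) f x)"

definition Delta :: "complex \<Rightarrow> (int \<times> int) operator" where
  "Delta u = (\<lambda>f x. f x - u * adjacency f x + 3 * u\<^sup>2 * f x)"

definition log_det_Delta :: "complex \<Rightarrow> complex" where
  "log_det_Delta u = Ln (det_vN (Delta u))"

definition cut_set :: "complex set" where
  "cut_set = {u. cmod u = 1 / sqrt 3} \<union> complex_of_real ` {- 1..- 1 / 3}
              \<union> complex_of_real ` {1 / 3..1}"

definition Omega :: "complex set" where
  "Omega = connected_component_set (- cut_set) 0"

text \<open>
  The principal branch of the complete elliptic integral of the first kind, as a function of
  the modulus \<open>k\<close> (not of \<open>k\<^sup>2\<close>). If \<open>k\<close> is not a real number with \<open>\<bar>k\<bar> \<ge> 1\<close>, the argument of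
  the square root avoids \<open>(-\<infinity>, 0]\<close>.
\<close>

definition elliptic_K :: "complex \<Rightarrow> complex" where
  "elliptic_K k =
     integral {0..pi / 2} (\<lambda>\<omega>. 1 / csqrt (1 - k\<^sup>2 * (complex_of_real (sin \<omega>))\<^sup>2))"

definition modulus_k :: "complex \<Rightarrow> complex" where
  "modulus_k u = 4 * u / (1 + 3 * u\<^sup>2)"

end

theory Submission
  imports Defs
begin

text \<open>
  Translation-invariant operators on \<open>l2\<close> of the grid are convolutions. If the symbol
  \<open>1 + 3 u\<^sup>2 - u (2 cos s + 2 cos t)\<close> of \<open>Delta u\<close> never equals \<open>z\<close>, then the Fourier coefficients
  of its shifted reciprocal decay exponentially, and convolution with them inverts \<open>z - Delta u\<close>;
  if it does equal \<open>z\<close>, damped characters are approximate eigenvectors. So the spectrum is the range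
  of the symbol, a segment, and the trace of the resolvent is the torus mean of the reciprocal.
  Cauchy's formula then turns the trace of the logarithm into the torus mean of \<open>Ln\<close> of the symbol.

  Differentiating under the integral gives \<open>u L'(u) = 1 - (1 - 3 u\<^sup>2) M\<close>, where \<open>M\<close> is the torus mean of
  the reciprocal symbol. A shear of the torus turns \<open>cos s + cos t\<close> into a product of cosines;
  one integration is then elementary and the other one is \<open>elliptic_K\<close>.
\<close>

section \<open>Convolution operators on the square-summable functions\<close>

text \<open>The contour inside \<open>Log_op\<close> is chosen by \<open>SOME\<close>, so only
  \<open>log_contour\<close> is known about it, and that condition speaks of the spectrum. Hence
  both inclusions between spectrum and symbol range matter. Spectrum inside range: a loop around the
  segment is admissible, so an admissible contour exists. Range inside spectrum: whatever contour
  was chosen avoids every symbol value and winds once around it, as Cauchy's formula requires.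

  A second obstacle is that \<open>log_det_Delta\<close> is \<open>Ln\<close> of \<open>exp\<close>
  of the trace. The two cancel because the imaginary part of the trace is a mean of arguments that
  stay in a compact part of the open interval from -pi to pi.

  The shape of \<open>Omega\<close> comes from the symbol: it can meet the slit only if u is real
  with 1/3 <= |u| <= 1, or if |u| >= 1/sqrt 3.

  One closed formula, for the Fourier coefficients of 1 / (1 - w cos s), serves twice: its geometric
  factor gives the decay of the Green function, and its zeroth case is the elementary integration
  that leads to \<open>elliptic_K\<close>.\<close>

lemma bij_left_translation: "bij (\<lambda>x :: 'a :: group_add. - g + x)"
  by (rule bij_betw_byWitness[where f' = "\<lambda>x. g + x"]) (auto simp flip: add.assoc)

lemma l2_translate:
  assumes "f \<in> l2"
  shows "translate g f \<in> l2"
  using assms summable_on_reindex_bij_betw[OF bij_left_translation[of g], of "\<lambda>x. (cmod (f x))\<^sup>2"]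
  unfolding l2_def translate_def by blast

lemma l2_cmult:
  assumes "f \<in> l2"
  shows "(\<lambda>x. c * f x) \<in> l2"
  using assms by (auto simp: l2_def norm_mult power_mult_distrib intro!: summable_on_cmult_right)

lemma l2_add:
  assumes "f \<in> l2" "g \<in> l2"
  shows "(\<lambda>x. f x + g x) \<in> l2"
proof -
  have "(cmod (a + b))\<^sup>2 \<le> 2 * (cmod a)\<^sup>2 + 2 * (cmod b)\<^sup>2" for a b
  proof -
    have "(cmod (a + b))\<^sup>2 \<le> (cmod a + cmod b)\<^sup>2"
      by (intro power_mono norm_triangle_ineq) auto
    then show ?thesis
      using sum_squares_bound[of "cmod a" "cmod b"] by (simp add: power2_sum)
  qed
  moreover have "(\<lambda>x. 2 * (cmod (f x))\<^sup>2 + 2 * (cmod (g x))\<^sup>2) summable_on UNIV"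
    using assms by (intro summable_on_add summable_on_cmult_right) (auto simp: l2_def)
  ultimately show ?thesis
    unfolding l2_def mem_Collect_eq by - (erule summable_on_comparison_test, auto)
qed

lemma cmod_le_l2norm:
  assumes "f \<in> l2"
  shows "cmod (f x) \<le> l2norm f"
proof -
  have "(cmod (f x))\<^sup>2 \<le> (\<Sum>\<^sub>\<infinity>x. (cmod (f x))\<^sup>2)"
    using finite_sum_le_infsum[of "\<lambda>x. (cmod (f x))\<^sup>2" UNIV "{x}"] assms by (simp add: l2_def)
  then show ?thesis
    unfolding l2norm_def by (rule real_le_rsqrt)
qed

definition convolution :: "('a::ab_group_add \<Rightarrow> complex) \<Rightarrow> ('a \<Rightarrow> complex) \<Rightarrow> 'a \<Rightarrow> complex" where
  "convolution G f = (\<lambda>x. \<Sum>\<^sub>\<infinity>y. G y * f (x - y))"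

lemma abs_summable_convolution:
  assumes "(\<lambda>y. cmod (G y)) summable_on UNIV" "f \<in> l2"
  shows "(\<lambda>y. cmod (G y * f (x - y))) summable_on UNIV"
proof (rule Infinite_Sum.abs_summable_on_comparison_test')
  show "(\<lambda>y. cmod (G y) * l2norm f) summable_on UNIV"
    using assms by (intro summable_on_cmult_left)
  show "cmod (G y * f (x - y)) \<le> cmod (G y) * l2norm f" for y
    using cmod_le_l2norm[OF assms(2), of "x - y"] by (simp add: norm_mult mult_left_mono)
qed

lemmas summable_convolution = abs_summable_convolution[THEN abs_summable_summable]

text \<open>Input for exchanging the order of summation: summed over x first, translation invariance
  makes every inner sum a multiple of the same squared norm.\<close>

lemma summable_weighted_square:
  fixes G :: "'a::ab_group_add \<Rightarrow> complex"
  assumes "(\<lambda>y. cmod (G y)) summable_on UNIV" "f \<in> l2"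
  shows "(\<lambda>(y, x). cmod (G y) * (cmod (f (x - y)))\<^sup>2) summable_on (UNIV \<times> UNIV)"
    and "(\<Sum>\<^sub>\<infinity>x. cmod (G y) * (cmod (f (x - y)))\<^sup>2) = cmod (G y) * (l2norm f)\<^sup>2"
proof -
  have sq: "(\<lambda>x. (cmod (f x))\<^sup>2) summable_on UNIV"
    using assms by (simp add: l2_def)
  have "(l2norm f)\<^sup>2 = (\<Sum>\<^sub>\<infinity>x. (cmod (f x))\<^sup>2)"
    by (simp add: l2norm_def infsum_nonneg)
  then have "((\<lambda>x. (cmod (f x))\<^sup>2) has_sum (l2norm f)\<^sup>2) UNIV"
    using sq by simp
  then have "((\<lambda>x. (cmod (f (x - y)))\<^sup>2) has_sum (l2norm f)\<^sup>2) UNIV" for y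
    using has_sum_reindex_bij_betw[OF bij_left_translation[of y], of "\<lambda>x. (cmod (f x))\<^sup>2"]
    by simp
  then have *: "((\<lambda>x. cmod (G y) * (cmod (f (x - y)))\<^sup>2) has_sum cmod (G y) * (l2norm f)\<^sup>2) UNIV" for y
    by (intro has_sum_cmult_right)
  then show "(\<Sum>\<^sub>\<infinity>x. cmod (G y) * (cmod (f (x - y)))\<^sup>2) = cmod (G y) * (l2norm f)\<^sup>2"
    by (rule infsumI)
  show "(\<lambda>(y, x). cmod (G y) * (cmod (f (x - y)))\<^sup>2) summable_on (UNIV \<times> UNIV)"
    by (rule summable_on_SigmaI[where g = "\<lambda>y. cmod (G y) * (l2norm f)\<^sup>2"])
      (use * assms in \<open>auto intro!: summable_on_cmult_left\<close>)
qed

text \<open>Cauchy-Schwarz with the weight \<open>cmod (G y)\<close> split into two square roots,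
  one of which stays with f. The inequality for finite sets passes to the infinite sum.\<close>

lemma convolution_pointwise_bound:
  assumes G: "(\<lambda>y. cmod (G y)) summable_on UNIV" and f: "f \<in> l2"
  shows "(cmod (convolution G f x))\<^sup>2 \<le>
    (\<Sum>\<^sub>\<infinity>y. cmod (G y)) * (\<Sum>\<^sub>\<infinity>y. cmod (G y) * (cmod (f (x - y)))\<^sup>2)"
proof -
  define N where "N = (\<Sum>\<^sub>\<infinity>y. cmod (G y))"
  define S where "S = (\<Sum>\<^sub>\<infinity>y. cmod (G y) * (cmod (f (x - y)))\<^sup>2)"
  have sumS: "(\<lambda>y. cmod (G y) * (cmod (f (x - y)))\<^sup>2) summable_on UNIV"
    using summable_weighted_square(1)[OF assms, THEN summable_on_swap[THEN iffD1]]
    by (intro summable_on_SigmaD1[of "\<lambda>x y. cmod (G y) * (cmod (f (x - y)))\<^sup>2" UNIV "\<lambda>_. UNIV" x])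
      (simp_all add: case_prod_unfold)
  have nonneg: "0 \<le> N" "0 \<le> S"
    unfolding N_def S_def by (auto intro!: infsum_nonneg)
  have "(\<Sum>\<^sub>\<infinity>y. cmod (G y * f (x - y))) \<le> sqrt (N * S)"
  proof (rule infsum_le_finite_sums)
    show "(\<lambda>y. cmod (G y * f (x - y))) summable_on UNIV"
      by (rule abs_summable_convolution[OF assms])
    fix F :: "'a set" assume "finite F" "F \<subseteq> UNIV"
    have "(\<Sum>y\<in>F. cmod (G y * f (x - y)))\<^sup>2 =
        (\<Sum>y\<in>F. sqrt (cmod (G y)) * (sqrt (cmod (G y)) * cmod (f (x - y))))\<^sup>2"
      by (simp add: norm_mult flip: mult.assoc)
    also have "\<dots> \<le> (\<Sum>y\<in>F. (sqrt (cmod (G y)))\<^sup>2) * (\<Sum>y\<in>F. (sqrt (cmod (G y)) * cmod (f (x - y)))\<^sup>2)"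
      by (rule Cauchy_Schwarz_ineq_sum)
    also have "\<dots> = (\<Sum>y\<in>F. cmod (G y)) * (\<Sum>y\<in>F. cmod (G y) * (cmod (f (x - y)))\<^sup>2)"
      by (simp add: power_mult_distrib)
    also have "\<dots> \<le> N * S"
      unfolding N_def S_def using \<open>finite F\<close> sumS G
      by (intro mult_mono finite_sum_le_infsum sum_nonneg infsum_nonneg) auto
    finally show "(\<Sum>y\<in>F. cmod (G y * f (x - y))) \<le> sqrt (N * S)"
      by (rule real_le_rsqrt)
  qed
  moreover have "cmod (convolution G f x) \<le> (\<Sum>\<^sub>\<infinity>y. cmod (G y * f (x - y)))"
    unfolding convolution_def by (rule norm_infsum_bound[OF abs_summable_convolution[OF assms]])
  ultimately have "cmod (convolution G f x) \<le> sqrt (N * S)"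
    by linarith
  then have "(cmod (convolution G f x))\<^sup>2 \<le> (sqrt (N * S))\<^sup>2"
    by (rule power_mono) simp
  then show ?thesis
    using nonneg by (simp add: N_def S_def)
qed

text \<open>Young's inequality for an absolutely summable kernel: the pointwise bound is summed over
  x, and the exchanged double sum factors.\<close>

lemma
  assumes G: "(\<lambda>y. cmod (G y)) summable_on UNIV" and f: "f \<in> l2"
  shows convolution_l2: "convolution G f \<in> l2"
    and l2norm_convolution_le: "l2norm (convolution G f) \<le> (\<Sum>\<^sub>\<infinity>y. cmod (G y)) * l2norm f"
proof -
  define N where "N = (\<Sum>\<^sub>\<infinity>y. cmod (G y))"
  have "N \<ge> 0"
    unfolding N_def by (auto intro!: infsum_nonneg)
  define S where "S x = (\<Sum>\<^sub>\<infinity>y. cmod (G y) * (cmod (f (x - y)))\<^sup>2)" for x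
  have le: "(cmod (convolution G f x))\<^sup>2 \<le> N * S x" for x
    unfolding N_def S_def by (rule convolution_pointwise_bound[OF assms])
  have "(\<lambda>(x, y). cmod (G y) * (cmod (f (x - y)))\<^sup>2) summable_on (UNIV \<times> UNIV)"
    using summable_weighted_square(1)[OF assms, THEN summable_on_swap[THEN iffD1]] by simp
  then have S: "S summable_on UNIV"
    unfolding S_def by (rule summable_on_Sigma_banach[of "\<lambda>x y. cmod (G y) * (cmod (f (x - y)))\<^sup>2"])
  have "infsum S UNIV = (\<Sum>\<^sub>\<infinity>y. \<Sum>\<^sub>\<infinity>x. cmod (G y) * (cmod (f (x - y)))\<^sup>2)"
    unfolding S_def by (rule infsum_swap_banach[symmetric], rule summable_weighted_square(1)[OF assms])
  also have "\<dots> = N * (l2norm f)\<^sup>2"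
    unfolding summable_weighted_square(2)[OF assms] N_def by (rule infsum_cmult_left')
  finally have S_eq: "infsum S UNIV = N * (l2norm f)\<^sup>2" .
  have NS: "(\<lambda>x. N * S x) summable_on UNIV"
    by (intro summable_on_cmult_right S)
  show l2: "convolution G f \<in> l2"
    unfolding l2_def mem_Collect_eq by (rule summable_on_comparison_test[OF NS]) (use le in auto)
  have "(\<Sum>\<^sub>\<infinity>x. (cmod (convolution G f x))\<^sup>2) \<le> (\<Sum>\<^sub>\<infinity>x. N * S x)"
    using l2 NS le by (intro infsum_mono) (auto simp: l2_def)
  also have "\<dots> = (N * l2norm f)\<^sup>2"
    by (simp add: infsum_cmult_right' S_eq power2_eq_square)
  finally have "l2norm (convolution G f) \<le> sqrt ((N * l2norm f)\<^sup>2)"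
    unfolding l2norm_def[of "convolution G f"] by (rule real_sqrt_le_mono)
  then show "l2norm (convolution G f) \<le> (\<Sum>\<^sub>\<infinity>y. cmod (G y)) * l2norm f"
    using \<open>N \<ge> 0\<close> by (simp add: N_def l2norm_def infsum_nonneg)
qed

lemma abs_summable_translate:
  assumes "(\<lambda>y. cmod (G y)) summable_on UNIV"
  shows "(\<lambda>y. cmod (translate g G y)) summable_on UNIV"
  using assms summable_on_reindex_bij_betw[OF bij_left_translation[of g], of "\<lambda>x. cmod (G x)"]
  unfolding translate_def by blast

lemma convolution_translate_right: "convolution G (translate g f) = translate g (convolution G f)"
  by (simp add: convolution_def translate_def fun_eq_iff algebra_simps)

lemma convolution_translate_left: "convolution (translate g G) f = translate g (convolution G f)"
proof
  fix x
  have "convolution (translate g G) f x = (\<Sum>\<^sub>\<infinity>y. G (- g + y) * f (- g + x - (- g + y)))"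
    by (simp add: convolution_def translate_def)
  also have "\<dots> = translate g (convolution G f) x"
    unfolding convolution_def translate_def
    by (rule infsum_reindex_bij_betw) (rule bij_left_translation)
  finally show "convolution (translate g G) f x = translate g (convolution G f) x" .
qed

lemma convolution_delta: "convolution delta_id f = f"
proof
  fix x
  have "(\<Sum>\<^sub>\<infinity>y. delta_id y * f (x - y)) = (\<Sum>\<^sub>\<infinity>y\<in>{0}. delta_id y * f (x - y))"
    by (rule infsum_cong_neutral) (auto simp: delta_id_def)
  then show "convolution delta_id f x = f x"
    by (simp add: convolution_def delta_id_def)
qed

lemma delta_id_l2: "delta_id \<in> l2"
  unfolding l2_def mem_Collect_eq
  by (rule finite_nonzero_values_imp_summable_on, rule finite_subset[of _ "{0}"])
    (auto simp: delta_id_def)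

lemma convolution_delta_right: "convolution G delta_id = G"
proof
  fix x
  have "(\<Sum>\<^sub>\<infinity>y. G y * delta_id (x - y)) = (\<Sum>\<^sub>\<infinity>y\<in>{x}. G y * delta_id (x - y))"
    by (rule infsum_cong_neutral) (auto simp: delta_id_def)
  then show "convolution G delta_id x = G x"
    by (simp add: convolution_def delta_id_def)
qed

text \<open>The common shape of all operators \<open>z - Delta u\<close>. With the two coefficients
  kept free, an operator and its symbol \<open>grid_symbol\<close> are described by the same
  pair.\<close>

definition grid_op :: "complex \<Rightarrow> complex \<Rightarrow> (int \<times> int) operator" where
  "grid_op \<alpha> \<beta> = (\<lambda>f x. \<alpha> * f x - \<beta> * adjacency f x)"

lemma shifted_Delta: "shifted (Delta u) z = grid_op (z - 1 - 3 * u\<^sup>2) (- u)"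
  by (simp add: shifted_def Delta_def grid_op_def fun_eq_iff algebra_simps)

lemma grid_op_l2:
  assumes "f \<in> l2"
  shows "grid_op \<alpha> \<beta> f \<in> l2"
proof -
  have "adjacency f \<in> l2"
    unfolding adjacency_def using assms by (intro l2_add l2_translate)
  then have "(\<lambda>x. \<alpha> * f x + (- \<beta>) * adjacency f x) \<in> l2"
    using assms by (intro l2_add l2_cmult)
  then show ?thesis
    by (simp add: grid_op_def)
qed

text \<open>Translations may be moved onto either factor of a convolution. Using
  \<open>has_sum\<close> lets the five series be combined termwise without separate summability
  arguments.\<close>

lemma convolution_grid_op:
  assumes G: "(\<lambda>y. cmod (G y)) summable_on UNIV" and f: "f \<in> l2"
  shows "convolution G (grid_op \<alpha> \<beta> f) = grid_op \<alpha> \<beta> (convolution G f)"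
    and "convolution (grid_op \<alpha> \<beta> G) f = grid_op \<alpha> \<beta> (convolution G f)"
proof -
  have right: "((\<lambda>y. G y * translate g f (x - y)) has_sum translate g (convolution G f) x) UNIV" for g x
    unfolding convolution_translate_right[symmetric] unfolding convolution_def
    by (rule has_sum_infsum[OF summable_convolution[OF G l2_translate[OF f]]])
  have left: "((\<lambda>y. translate g G y * f (x - y)) has_sum translate g (convolution G f) x) UNIV" for g x
    unfolding convolution_translate_left[symmetric] unfolding convolution_def
    by (rule has_sum_infsum[OF summable_convolution[OF abs_summable_translate[OF G] f]])
  have base: "((\<lambda>y. G y * f (x - y)) has_sum convolution G f x) UNIV" for x
    unfolding convolution_def by (rule has_sum_infsum[OF summable_convolution[OF G f]])
  show "convolution G (grid_op \<alpha> \<beta> f) = grid_op \<alpha> \<beta> (convolution G f)"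
  proof
    fix x
    have "((\<lambda>y. \<alpha> * (G y * f (x - y)) + (- \<beta>) * (G y * translate (1, 0) f (x - y) + G y * translate (- 1, 0) f (x - y)
        + G y * translate (0, 1) f (x - y) + G y * translate (0, - 1) f (x - y))) has_sum
        \<alpha> * convolution G f x + (- \<beta>) * (translate (1, 0) (convolution G f) x + translate (- 1, 0) (convolution G f) x
        + translate (0, 1) (convolution G f) x + translate (0, - 1) (convolution G f) x)) UNIV"
      by (intro has_sum_add has_sum_cmult_right base right)
    then have "((\<lambda>y. G y * grid_op \<alpha> \<beta> f (x - y)) has_sum grid_op \<alpha> \<beta> (convolution G f) x) UNIV"
      by (simp add: grid_op_def adjacency_def algebra_simps)
    then show "convolution G (grid_op \<alpha> \<beta> f) x = grid_op \<alpha> \<beta> (convolution G f) x"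
      unfolding convolution_def[of G "grid_op \<alpha> \<beta> f"] by (rule infsumI)
  qed
  show "convolution (grid_op \<alpha> \<beta> G) f = grid_op \<alpha> \<beta> (convolution G f)"
  proof
    fix x
    have "((\<lambda>y. \<alpha> * (G y * f (x - y)) + (- \<beta>) * (translate (1, 0) G y * f (x - y) + translate (- 1, 0) G y * f (x - y)
        + translate (0, 1) G y * f (x - y) + translate (0, - 1) G y * f (x - y))) has_sum
        \<alpha> * convolution G f x + (- \<beta>) * (translate (1, 0) (convolution G f) x + translate (- 1, 0) (convolution G f) x
        + translate (0, 1) (convolution G f) x + translate (0, - 1) (convolution G f) x)) UNIV"
      by (intro has_sum_add has_sum_cmult_right base left)
    then have "((\<lambda>y. grid_op \<alpha> \<beta> G y * f (x - y)) has_sum grid_op \<alpha> \<beta> (convolution G f) x) UNIV"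
      by (simp add: grid_op_def adjacency_def algebra_simps)
    then show "convolution (grid_op \<alpha> \<beta> G) f x = grid_op \<alpha> \<beta> (convolution G f) x"
      unfolding convolution_def[of "grid_op \<alpha> \<beta> G" f] by (rule infsumI)
  qed
qed

text \<open>Convolution with a summable fundamental solution G inverts the operator: from the right
  because the operator may be applied to the kernel, from the left because it commutes with the
  convolution. Young's inequality is the bound on the inverse, and the inverse sends
  \<open>delta_id\<close> to G itself.\<close>

lemma grid_op_inverse:
  assumes G: "(\<lambda>y. cmod (G y)) summable_on UNIV" and fund: "grid_op \<alpha> \<beta> G = delta_id"
  shows "bij_betw (grid_op \<alpha> \<beta>) l2 l2"
    and "\<exists>C. \<forall>f\<in>l2. l2norm f \<le> C * l2norm (grid_op \<alpha> \<beta> f)"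
    and "inv_into l2 (grid_op \<alpha> \<beta>) delta_id = G"
proof -
  have R: "grid_op \<alpha> \<beta> (convolution G f) = f" if "f \<in> l2" for f
    using convolution_grid_op(2)[OF G that, of \<alpha> \<beta>] unfolding fund convolution_delta by (rule sym)
  have L: "convolution G (grid_op \<alpha> \<beta> f) = f" if "f \<in> l2" for f
    by (rule trans[OF convolution_grid_op(1)[OF G that] R[OF that]])
  show bij: "bij_betw (grid_op \<alpha> \<beta>) l2 l2"
    by (rule bij_betw_byWitness[where f' = "convolution G"])
      (use R L in \<open>auto intro: grid_op_l2 convolution_l2[OF G]\<close>)
  show "\<exists>C. \<forall>f\<in>l2. l2norm f \<le> C * l2norm (grid_op \<alpha> \<beta> f)"
  proof (intro exI ballI)
    fix f :: "int \<times> int \<Rightarrow> complex" assume f: "f \<in> l2"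
    show "l2norm f \<le> (\<Sum>\<^sub>\<infinity>y. cmod (G y)) * l2norm (grid_op \<alpha> \<beta> f)"
      using l2norm_convolution_le[OF G grid_op_l2[OF f, of \<alpha> \<beta>]] unfolding L[OF f] .
  qed
  have "G \<in> l2"
    using convolution_l2[OF G delta_id_l2] by (simp add: convolution_delta_right)
  then show "inv_into l2 (grid_op \<alpha> \<beta>) delta_id = G"
    using bij fund by (intro inv_into_f_eq) (auto simp: bij_betw_def)
qed

section \<open>Fourier coefficients of \<open>1 / (1 - w cos s)\<close>\<close>

lemma continuous_on_interval_bounded:
  fixes f :: "real \<Rightarrow> complex"
  assumes "continuous_on {a..b} f"
  obtains B where "\<And>s. s \<in> {a..b} \<Longrightarrow> cmod (f s) \<le> B"
  using compact_imp_bounded[OF compact_continuous_image[OF assms compact_Icc]]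
  unfolding bounded_iff by blast

text \<open>Otherwise w would be real with absolute value at least 1, and then 1/w is a value of the
  cosine. This keeps the square root of 1 - w^2 in the open right half plane.\<close>

lemma one_minus_square_not_nonpos:
  fixes w :: complex
  assumes "\<And>s. 1 - w * complex_of_real (cos s) \<noteq> 0"
  shows "1 - w\<^sup>2 \<notin> \<real>\<^sub>\<le>\<^sub>0"
proof
  assume "1 - w\<^sup>2 \<in> \<real>\<^sub>\<le>\<^sub>0"
  then obtain r where r: "r \<le> 0" "1 - w\<^sup>2 = complex_of_real r"
    by (auto elim: nonpos_Reals_cases)
  define v where "v = sqrt (1 - r)"
  have v: "v \<ge> 1" and "w\<^sup>2 = (complex_of_real v)\<^sup>2"
    using r by (auto simp: v_def algebra_simps simp flip: of_real_power)
  then have v': "0 \<le> 1 / v" "1 / v \<le> 1"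
    by auto
  from \<open>w\<^sup>2 = (complex_of_real v)\<^sup>2\<close> consider "w = complex_of_real v" | "w = complex_of_real (- v)"
    by (auto simp: power2_eq_iff)
  then show False
  proof cases
    case 1
    have "cos (arccos (1 / v)) = 1 / v"
      using v' by (intro cos_arccos) linarith+
    then show False
      using assms[of "arccos (1 / v)"] v 1 by (auto simp flip: of_real_mult)
  next
    case 2
    have "cos (arccos (- (1 / v))) = - (1 / v)"
      using v' by (intro cos_arccos) linarith+
    then show False
      using assms[of "arccos (- (1 / v))"] v 2 by (auto simp flip: of_real_mult)
  qed
qed

lemma Re_csqrt_pos:
  assumes "z \<notin> \<real>\<^sub>\<le>\<^sub>0"
  shows "Re (csqrt z) > 0"
proof (rule ccontr)
  assume "\<not> Re (csqrt z) > 0"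
  then have "Re (csqrt z) = 0"
    using Re_csqrt[of z] by linarith
  then have "(csqrt z)\<^sup>2 = complex_of_real (- (Im (csqrt z))\<^sup>2)"
    by (simp add: complex_eq_iff power2_eq_square del: csqrt.simps power2_csqrt)
  then have "z = complex_of_real (- (Im (csqrt z))\<^sup>2)"
    by (simp only: power2_csqrt)
  moreover have "complex_of_real (- (Im (csqrt z))\<^sup>2) \<in> \<real>\<^sub>\<le>\<^sub>0"
    unfolding nonpos_Reals_of_real_iff by simp
  ultimately show False
    using assms by simp
qed

lemma integral_cos_nat:
  assumes "m > 0"
  shows "integral {0..2 * pi} (\<lambda>s. complex_of_real (cos (real m * s))) = 0"
proof -
  have "((\<lambda>s. cos (real m * s)) has_integral (sin (real m * (2 * pi)) / m - sin (real m * 0) / m)) {0..2 * pi}"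
    using assms by (intro fundamental_theorem_of_calculus)
      (auto intro!: derivative_eq_intros simp flip: has_real_derivative_iff_has_vector_derivative)
  moreover have "sin (real m * (2 * pi)) = 0"
    using sin_npi[of "2 * m"] by (simp add: mult_ac)
  ultimately have "((\<lambda>s. complex_of_real (cos (real m * s))) has_integral complex_of_real 0) {0..2 * pi}"
    by (intro has_integral_of_real) simp
  then show ?thesis
    by (simp add: integral_unique)
qed

text \<open>q is the root of w q^2 - 2 q + w = 0 inside the unit disc. The form w / (1 + \<sigma>),
  rather than (1 - \<sigma>) / w, also covers w = 0.\<close>

lemma joukowski_root:
  fixes w :: complex
  assumes w: "1 - w\<^sup>2 \<notin> \<real>\<^sub>\<le>\<^sub>0"
  defines "\<sigma> \<equiv> csqrt (1 - w\<^sup>2)"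
  defines "q \<equiv> w / (1 + \<sigma>)"
  shows "cmod q < 1" "w * (1 + q\<^sup>2) = 2 * q" "1 - w * q = \<sigma>" "\<sigma> \<noteq> 0" "1 + \<sigma> \<noteq> 0"
proof -
  have Re: "Re \<sigma> > 0"
    unfolding \<sigma>_def by (rule Re_csqrt_pos[OF w])
  have sq: "\<sigma>\<^sup>2 = 1 - w\<^sup>2"
    by (simp add: \<sigma>_def)
  show "\<sigma> \<noteq> 0" and nz: "1 + \<sigma> \<noteq> 0"
    using Re by (auto simp: complex_eq_iff)
  have w2: "w * w = (1 + \<sigma>) * (1 - \<sigma>)"
    using sq by (simp add: power2_eq_square algebra_simps)
  show 1: "1 - w * q = \<sigma>"
    using nz w2 by (simp add: q_def field_simps)
  have wq: "w = (1 + \<sigma>) * q"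
    using nz by (simp add: q_def)
  have wq': "w * q = 1 - \<sigma>"
    using 1 by (simp add: algebra_simps)
  have "w * (1 + q\<^sup>2) = w + (w * q) * q"
    by (simp add: power2_eq_square algebra_simps)
  also have "\<dots> = (1 + \<sigma>) * q + (1 - \<sigma>) * q"
    unfolding wq' using wq by simp
  finally show "w * (1 + q\<^sup>2) = 2 * q"
    by (simp add: algebra_simps)
  \<comment> \<open>A point of the right half plane is closer to 1 than to -1; the squared modulus
    of q is exactly the quotient of these two distances.\<close>
  have "(cmod (1 - \<sigma>))\<^sup>2 < (cmod (1 + \<sigma>))\<^sup>2"
    using Re unfolding cmod_power2 by (simp add: power2_eq_square algebra_simps)
  then have lt: "cmod (1 - \<sigma>) < cmod (1 + \<sigma>)"
    by (rule power_less_imp_less_base) simp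
  have "(cmod q)\<^sup>2 = cmod (w * w) / (cmod (1 + \<sigma>))\<^sup>2"
    by (simp add: q_def norm_divide norm_mult power2_eq_square)
  also have "\<dots> = cmod (1 - \<sigma>) / cmod (1 + \<sigma>)"
    using nz by (simp add: w2 norm_mult power2_eq_square)
  also have "\<dots> < 1"
    using lt nz by simp
  finally show "cmod q < 1"
    by (simp add: power_less_one_iff abs_square_less_1)
qed

text \<open>
  The integrals \<open>C m\<close> satisfy a three-term recurrence whose characteristic roots are \<open>q\<close> and
  \<open>1/q\<close>; being bounded, they have no component along \<open>1/q\<close>.
\<close>

lemma integral_cos_div_one_minus_cos:
  fixes w :: complex
  assumes nz: "\<And>s. 1 - w * complex_of_real (cos s) \<noteq> 0"
  defines "\<sigma> \<equiv> csqrt (1 - w\<^sup>2)"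
  defines "q \<equiv> w / (1 + \<sigma>)"
  shows "integral {0..2 * pi} (\<lambda>s. complex_of_real (cos (real m * s)) / (1 - w * complex_of_real (cos s)))
    = 2 * complex_of_real pi * q ^ m / \<sigma>"
proof -
  note J = joukowski_root[OF one_minus_square_not_nonpos[OF nz], folded \<sigma>_def, folded q_def]
  define h where "h m s = complex_of_real (cos (real m * s)) / (1 - w * complex_of_real (cos s))" for m s
  define C where "C m = integral {0..2 * pi} (h m)" for m
  have cont: "continuous_on A (h m)" for m A
    unfolding h_def by (intro continuous_intros) (use nz in auto)
  have int: "h m integrable_on {0..2 * pi}" for m
    by (rule integrable_continuous_real[OF cont])
  have int_cos: "(\<lambda>s. complex_of_real (cos (real m * s))) integrable_on {0..2 * pi}" for m
    by (intro integrable_continuous_real continuous_intros)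
  have rec: "w * (C (Suc (Suc m)) + C m) = 2 * C (Suc m)" for m
  proof -
    have eq: "w * (h (Suc (Suc m)) s + h m s) = 2 * h (Suc m) s - 2 * complex_of_real (cos (real (Suc m) * s))" for s
    proof -
      have "cos (real (Suc (Suc m)) * s) + cos (real m * s) = 2 * cos (real (Suc m) * s) * cos s"
        using cos_times_cos[of "real (Suc m) * s" s] by (simp add: algebra_simps)
      then have *: "complex_of_real (cos (real (Suc (Suc m)) * s)) + complex_of_real (cos (real m * s))
          = 2 * complex_of_real (cos (real (Suc m) * s)) * complex_of_real (cos s)"
        by (metis of_real_add of_real_mult of_real_numeral)
      have "w * (h (Suc (Suc m)) s + h m s) =
          w * (2 * complex_of_real (cos (real (Suc m) * s)) * complex_of_real (cos s)) / (1 - w * complex_of_real (cos s))"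
        unfolding h_def add_divide_distrib[symmetric] * by simp
      also have "\<dots> = 2 * h (Suc m) s - 2 * complex_of_real (cos (real (Suc m) * s))"
        unfolding h_def using nz[of s] by (simp add: field_simps del: of_nat_Suc)
      finally show ?thesis .
    qed
    have "w * (C (Suc (Suc m)) + C m) = integral {0..2 * pi} (\<lambda>s. w * (h (Suc (Suc m)) s + h m s))"
      unfolding C_def by (simp add: integral_add int)
    also have "\<dots> = 2 * C (Suc m) - 2 * integral {0..2 * pi} (\<lambda>s. complex_of_real (cos (real (Suc m) * s)))"
      unfolding eq C_def using int int_cos[of "Suc m"]
      by (subst integral_diff) (auto intro!: integrable_on_mult_right)
    finally show ?thesis
      unfolding integral_cos_nat[OF zero_less_Suc] by simp
  qed
  \<comment> \<open>The recurrence is homogeneous; this relation supplies the scale, since the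
    constant function 1 has a nonzero integral.\<close>
  have rec0: "C 0 - w * C 1 = 2 * complex_of_real pi"
  proof -
    have "C 0 - w * C 1 = integral {0..2 * pi} (\<lambda>s. h 0 s - w * h 1 s)"
      unfolding C_def using int by (subst integral_diff) (auto intro!: integrable_on_mult_right)
    also have "(\<lambda>s. h 0 s - w * h 1 s) = (\<lambda>s. 1)"
      unfolding h_def using nz by (simp add: fun_eq_iff field_simps)
    finally show ?thesis
      by (simp add: scaleR_conv_of_real)
  qed
  \<comment> \<open>D annihilates the solution growing like powers of q and isolates the one along
    1/q. It satisfies D m = q D (m + 1), so D 0 is q^m times a bounded quantity for every m, and
    therefore vanishes.\<close>
  define D where "D m = C (Suc m) - q * C m" for m
  have D: "D m = q * D (Suc m)" for m
  proof -
    have "(1 + q\<^sup>2) * (2 * C (Suc m)) = 2 * q * (C (Suc (Suc m)) + C m)"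
      using rec[of m] J(2) by (metis mult.commute mult.assoc)
    then have "2 * ((1 + q\<^sup>2) * C (Suc m)) = 2 * (q * (C (Suc (Suc m)) + C m))"
      by (simp add: mult_ac)
    then have "(1 + q\<^sup>2) * C (Suc m) = q * (C (Suc (Suc m)) + C m)"
      by simp
    then show ?thesis
      by (simp add: D_def power2_eq_square algebra_simps)
  qed
  have D0: "D 0 = q ^ m * D m" for m
  proof (induction m)
    case (Suc m)
    also have "q ^ m * D m = q ^ Suc m * D (Suc m)"
      by (subst D) simp
    finally show ?case .
  qed simp
  obtain B where B: "\<And>s. s \<in> {0..2 * pi} \<Longrightarrow> cmod (1 / (1 - w * complex_of_real (cos s))) \<le> B"
  proof (rule continuous_on_interval_bounded)
    show "continuous_on {0..2 * pi} (\<lambda>s. 1 / (1 - w * complex_of_real (cos s)))"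
      by (intro continuous_intros) (use nz in auto)
  qed (rule that)
  have Cb: "cmod (C m) \<le> B * (2 * pi - 0)" for m
    unfolding C_def
  proof (rule integral_bound[OF _ cont])
    fix s assume s: "s \<in> {0..2 * pi}"
    have "cmod (h m s) = \<bar>cos (real m * s)\<bar> * cmod (1 / (1 - w * complex_of_real (cos s)))"
      unfolding h_def by (simp add: norm_divide)
    also have "\<dots> \<le> 1 * B"
      using B[OF s] by (intro mult_mono) auto
    finally show "cmod (h m s) \<le> B" by simp
  qed simp
  have Db: "cmod (D m) \<le> 2 * (B * (2 * pi))" for m
  proof -
    have "cmod (D m) \<le> cmod (C (Suc m)) + cmod q * cmod (C m)"
      unfolding D_def norm_mult[symmetric] by (rule norm_triangle_ineq4)
    also have "\<dots> \<le> cmod (C (Suc m)) + 1 * cmod (C m)"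
      using J(1) by (intro add_left_mono mult_right_mono) auto
    finally show ?thesis
      using Cb[of m] Cb[of "Suc m"] by simp
  qed
  have "(\<lambda>m. cmod q ^ m * (2 * (B * (2 * pi)))) \<longlonglongrightarrow> 0"
    using J(1) by (intro tendsto_mult_left_zero LIMSEQ_power_zero) simp
  moreover have "cmod (D 0) \<le> cmod q ^ m * (2 * (B * (2 * pi)))" for m
  proof -
    have "cmod (D 0) = cmod q ^ m * cmod (D m)"
      using D0[of m] by (simp add: norm_mult norm_power)
    then show ?thesis
      using Db[of m] by (simp add: mult_left_mono)
  qed
  ultimately have "cmod (D 0) \<le> 0"
    by (intro LIMSEQ_le_const) auto
  \<comment> \<open>For nonzero q the vanishing of D 0 propagates upwards; for q = 0 the relation D
    m = q D (m + 1) gives it at once.\<close>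
  have "D m = 0" for m
  proof (induction m)
    case (Suc m)
    show ?case
    proof (cases "q = 0")
      case True
      then show ?thesis
        using D[of "Suc m"] by simp
    qed (use D[of m] Suc in auto)
  qed (use \<open>cmod (D 0) \<le> 0\<close> in simp)
  then have step: "C (Suc m) = q * C m" for m
    by (simp add: D_def)
  have "C 0 * (1 - w * q) = 2 * complex_of_real pi"
    using rec0 step[of 0] by (simp add: algebra_simps)
  then have C0: "C 0 = 2 * complex_of_real pi / \<sigma>"
    unfolding J(3) using J(4) by (simp add: nonzero_eq_divide_eq)
  have "C m = 2 * complex_of_real pi * q ^ m / \<sigma>"
    by (induction m) (simp_all add: C0 step)
  then show ?thesis
    by (simp add: C_def h_def[abs_def])
qed

section \<open>The Green function of the grid\<close>

definition torus :: "(real \<times> real) set" where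
  "torus = cbox (0, 0) (2 * pi, 2 * pi)"

definition torus_mean :: "(real \<times> real \<Rightarrow> complex) \<Rightarrow> complex" where
  "torus_mean F = 1 / (2 * complex_of_real pi)\<^sup>2 * integral torus F"

lemma compact_torus: "compact torus"
  by (simp add: torus_def)

lemma integrable_on_torus:
  fixes F :: "real \<times> real \<Rightarrow> complex"
  assumes "continuous_on torus F"
  shows "F integrable_on torus"
  using assms integrable_continuous unfolding torus_def by blast

lemma torus_mean_add:
  assumes "continuous_on torus F" "continuous_on torus G"
  shows "torus_mean (\<lambda>p. F p + G p) = torus_mean F + torus_mean G"
  using assms by (simp add: torus_mean_def integral_add integrable_on_torus distrib_left)

lemma torus_mean_cmult: "torus_mean (\<lambda>p. c * F p) = c * torus_mean F"
  by (simp add: torus_mean_def)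

lemma torus_mean_divide: "torus_mean (\<lambda>p. F p / c) = torus_mean F / c"
  using torus_mean_cmult[of "1 / c" F] by simp

lemma torus_mean_diff:
  assumes "continuous_on torus F" "continuous_on torus G"
  shows "torus_mean (\<lambda>p. F p - G p) = torus_mean F - torus_mean G"
  using assms by (simp add: torus_mean_def integral_diff integrable_on_torus right_diff_distrib)

lemma torus_mean_const: "torus_mean (\<lambda>p. c) = c"
proof -
  have "integral torus (\<lambda>p. c) = (2 * pi) ^ 2 *\<^sub>R c"
    by (simp add: torus_def content_Pair power2_eq_square)
  then show ?thesis
    by (simp add: torus_mean_def scaleR_conv_of_real)
qed

lemma torus_mean_iterated:
  assumes "continuous_on torus F"
  shows "torus_mean F = 1 / (2 * complex_of_real pi)\<^sup>2 *
    integral {0..2 * pi} (\<lambda>s. integral {0..2 * pi} (\<lambda>t. F (s, t)))"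
  using integral_prod_continuous[OF assms[unfolded torus_def]]
  by (simp add: torus_mean_def torus_def)

lemma torus_mean_swap:
  assumes "continuous_on torus F"
  shows "torus_mean (\<lambda>p. F (snd p, fst p)) = torus_mean F"
  using integral_swap_2dim[of "(0::real)" "0::real" "2 * pi" "2 * pi" "\<lambda>x y. F (x, y)"] assms
  by (simp add: torus_mean_def torus_def case_prod_unfold)

lemma torus_mean_bound:
  assumes F: "continuous_on torus F" and B: "\<And>p. p \<in> torus \<Longrightarrow> cmod (F p) \<le> B"
  shows "cmod (torus_mean F) \<le> B"
proof -
  have "(0, 0) \<in> torus"
    by (simp add: torus_def cbox_Pair_eq)
  then have "B \<ge> 0"
    using B order_trans[OF norm_ge_zero] by blast
  then have "cmod (integral torus F) \<le> B * measure lborel (cbox (0::real, 0::real) (2 * pi, 2 * pi))"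
    using has_integral_bound[of B F "integral torus F" "(0, 0)" "(2 * pi, 2 * pi)"]
      integrable_integral[OF integrable_on_torus[OF F]] B by (auto simp: torus_def)
  also have "\<dots> = B * (2 * pi)\<^sup>2"
    by (simp add: content_Pair power2_eq_square)
  finally show ?thesis
    by (simp add: torus_mean_def norm_mult norm_divide norm_power field_simps)
qed

section \<open>Symbol, cosine characters and Green function\<close>

definition grid_symbol :: "complex \<Rightarrow> complex \<Rightarrow> real \<times> real \<Rightarrow> complex" where
  "grid_symbol \<alpha> \<beta> p = \<alpha> - \<beta> * (2 * complex_of_real (cos (fst p)) + 2 * complex_of_real (cos (snd p)))"

lemma continuous_on_grid_symbol [continuous_intros]: "continuous_on A (grid_symbol \<alpha> \<beta>)"
  unfolding grid_symbol_def by (intro continuous_intros)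

text \<open>Cosines replace exponentials because the symbol is even in each variable, so the sine
  parts would not contribute to the Fourier coefficients of its reciprocal.\<close>

definition character_pair :: "int \<Rightarrow> int \<Rightarrow> real \<times> real \<Rightarrow> complex" where
  "character_pair m n p = complex_of_real (cos (real_of_int m * fst p) * cos (real_of_int n * snd p))"

lemma continuous_on_character_pair [continuous_intros]: "continuous_on A (character_pair m n)"
  unfolding character_pair_def by (intro continuous_intros)

definition green :: "complex \<Rightarrow> complex \<Rightarrow> int \<times> int \<Rightarrow> complex" where
  "green \<alpha> \<beta> x = torus_mean (\<lambda>p. character_pair (fst x) (snd x) p / grid_symbol \<alpha> \<beta> p)"

text \<open>As a function of the indices, a character is an eigenvector of the adjacency operator;
  this is the addition theorem for the cosine in each coordinate.\<close>

lemma character_pair_neighbours: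
  "character_pair (m - 1) n p + character_pair (m + 1) n p + character_pair m (n - 1) p + character_pair m (n + 1) p
    = character_pair m n p * (2 * complex_of_real (cos (fst p)) + 2 * complex_of_real (cos (snd p)))"
proof -
  have "cos ((x - 1) * s) + cos ((x + 1) * s) = cos (x * s) * (2 * cos s)" for x s :: real
    by (simp add: algebra_simps cos_add cos_diff)
  note * = this[of "real_of_int m" "fst p"] this[of "real_of_int n" "snd p"]
  have "cos (real_of_int (m - 1) * fst p) * cos (real_of_int n * snd p)
    + cos (real_of_int (m + 1) * fst p) * cos (real_of_int n * snd p)
    + cos (real_of_int m * fst p) * cos (real_of_int (n - 1) * snd p)
    + cos (real_of_int m * fst p) * cos (real_of_int (n + 1) * snd p)
    = (cos ((real_of_int m - 1) * fst p) + cos ((real_of_int m + 1) * fst p)) * cos (real_of_int n * snd p)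
    + cos (real_of_int m * fst p) * (cos ((real_of_int n - 1) * snd p) + cos ((real_of_int n + 1) * snd p))"
    by (simp only: distrib_left distrib_right add.assoc of_int_add of_int_diff of_int_1)
  also have "\<dots> = cos (real_of_int m * fst p) * cos (real_of_int n * snd p) * (2 * cos (fst p) + 2 * cos (snd p))"
    unfolding * by (simp only: distrib_left mult_ac)
  finally have "complex_of_real (cos (real_of_int (m - 1) * fst p) * cos (real_of_int n * snd p)
    + cos (real_of_int (m + 1) * fst p) * cos (real_of_int n * snd p)
    + cos (real_of_int m * fst p) * cos (real_of_int (n - 1) * snd p)
    + cos (real_of_int m * fst p) * cos (real_of_int (n + 1) * snd p))
    = complex_of_real (cos (real_of_int m * fst p) * cos (real_of_int n * snd p) * (2 * cos (fst p) + 2 * cos (snd p)))"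
    by (rule arg_cong)
  then show ?thesis
    unfolding character_pair_def by (simp only: of_real_add of_real_mult of_real_numeral)
qed

lemma cos_int_abs: "cos (real_of_int m * s) = cos (real (nat \<bar>m\<bar>) * s)"
  by (cases "m \<ge> 0") auto

lemma torus_mean_character_pair: "torus_mean (character_pair m n) = delta_id (m, n)"
proof -
  define c where "c m = integral {0..2 * pi} (\<lambda>s. complex_of_real (cos (real_of_int m * s)))" for m
  have c: "c m = (if m = 0 then 2 * complex_of_real pi else 0)" for m
    using integral_cos_nat[of "nat \<bar>m\<bar>"] by (auto simp: c_def cos_int_abs[of m] scaleR_conv_of_real)
  have "integral {0..2 * pi} (\<lambda>s. integral {0..2 * pi} (\<lambda>t. character_pair m n (s, t))) = c m * c n"
    by (simp add: character_pair_def c_def)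
  then show ?thesis
    by (subst torus_mean_iterated[OF continuous_on_character_pair])
      (simp add: c delta_id_def zero_prod_def power2_eq_square)
qed

context
  fixes \<alpha> \<beta> :: complex
  assumes nz: "\<And>p. grid_symbol \<alpha> \<beta> p \<noteq> 0"
begin

lemma continuous_on_green_integrand:
  "continuous_on A (\<lambda>p. character_pair m n p / grid_symbol \<alpha> \<beta> p)"
  by (intro continuous_intros) (use nz in auto)

text \<open>Acting on the indices multiplies the integrand by the symbol, which cancels the
  denominator. What remains is the mean of a character.\<close>

lemma grid_op_green: "grid_op \<alpha> \<beta> (green \<alpha> \<beta>) = delta_id"
proof
  fix x :: "int \<times> int"
  obtain m n where x: "x = (m, n)" by fastforce
  define e where "e m n p = character_pair m n p / grid_symbol \<alpha> \<beta> p" for m n p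
  have cont: "continuous_on torus (e m n)" for m n
    unfolding e_def by (rule continuous_on_green_integrand)
  have "grid_op \<alpha> \<beta> (green \<alpha> \<beta>) x = \<alpha> * torus_mean (e m n) - \<beta> *
    (torus_mean (e (m - 1) n) + torus_mean (e (m + 1) n) + torus_mean (e m (n - 1)) + torus_mean (e m (n + 1)))"
    by (simp add: grid_op_def adjacency_def translate_def green_def x e_def[abs_def] add_ac)
  also have "\<dots> = torus_mean (\<lambda>p. \<alpha> * e m n p - \<beta> * (e (m - 1) n p + e (m + 1) n p + e m (n - 1) p + e m (n + 1) p))"
    using cont by (simp add: torus_mean_add torus_mean_diff torus_mean_cmult continuous_intros)
  also have "(\<lambda>p. \<alpha> * e m n p - \<beta> * (e (m - 1) n p + e (m + 1) n p + e m (n - 1) p + e m (n + 1) p)) = character_pair m n"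
  proof
    fix p
    have "e (m - 1) n p + e (m + 1) n p + e m (n - 1) p + e m (n + 1) p
      = e m n p * (2 * complex_of_real (cos (fst p)) + 2 * complex_of_real (cos (snd p)))"
      unfolding e_def add_divide_distrib[symmetric] character_pair_neighbours by simp
    then have "\<alpha> * e m n p - \<beta> * (e (m - 1) n p + e (m + 1) n p + e m (n - 1) p + e m (n + 1) p) = e m n p * grid_symbol \<alpha> \<beta> p"
      by (simp add: grid_symbol_def algebra_simps)
    then show "\<alpha> * e m n p - \<beta> * (e (m - 1) n p + e (m + 1) n p + e m (n - 1) p + e m (n + 1) p) = character_pair m n p"
      using nz[of p] by (simp add: e_def)
  qed
  finally show "grid_op \<alpha> \<beta> (green \<alpha> \<beta>) x = delta_id x"
    by (simp add: torus_mean_character_pair x)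
qed

lemma green_commute: "green \<alpha> \<beta> (m, n) = green \<alpha> \<beta> (n, m)"
  using torus_mean_swap[OF continuous_on_green_integrand[of torus n m]]
  by (simp add: green_def character_pair_def grid_symbol_def add.commute mult.commute)

text \<open>For fixed s the symbol is a(s) (1 - w(s) cos t), so the t-integral is known in closed
  form and carries the factor q(s)^|n|. This controls one coordinate only.\<close>

lemma green_decay:
  obtains K \<rho> where "0 \<le> \<rho>" "\<rho> < 1" "\<And>m n. cmod (green \<alpha> \<beta> (m, n)) \<le> K * \<rho> ^ nat \<bar>n\<bar>"
proof -
  define a where "a s = \<alpha> - 2 * \<beta> * complex_of_real (cos s)" for s
  define w where "w s = 2 * \<beta> / a s" for s
  define \<sigma> where "\<sigma> s = csqrt (1 - (w s)\<^sup>2)" for s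
  define q where "q s = w s / (1 + \<sigma> s)" for s
  \<comment> \<open>At t = pi/2 the second cosine vanishes and the symbol reduces to
    \<open>a s\<close>.\<close>
  have a_nz: "a s \<noteq> 0" for s
    using nz[of "(s, pi / 2)"] by (simp add: a_def grid_symbol_def algebra_simps)
  have sym: "grid_symbol \<alpha> \<beta> (s, t) = a s * (1 - w s * complex_of_real (cos t))" for s t
    using a_nz[of s] by (simp add: grid_symbol_def w_def a_def field_simps)
  have w_nz: "1 - w s * complex_of_real (cos t) \<noteq> 0" for s t
    using nz[of "(s, t)"] by (auto simp: sym)
  note np = one_minus_square_not_nonpos[OF w_nz]
  note J = joukowski_root[OF np, folded \<sigma>_def, folded q_def]
  have cont_a: "continuous_on A a" for A
    unfolding a_def by (intro continuous_intros)
  have cont_w: "continuous_on A w" for A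
    unfolding w_def by (intro continuous_intros cont_a) (use a_nz in auto)
  have cont_\<sigma>: "continuous_on A \<sigma>" for A
    unfolding \<sigma>_def by (intro continuous_on_compose2[OF continuous_on_csqrt] continuous_intros cont_w)
      (use np in \<open>auto simp: complex_nonpos_Reals_iff\<close>)
  have cont_q: "continuous_on A q" for A
    unfolding q_def by (intro continuous_intros cont_w cont_\<sigma>) (use J in auto)
  have inner: "integral {0..2 * pi} (\<lambda>t. character_pair m n (s, t) / grid_symbol \<alpha> \<beta> (s, t))
      = complex_of_real (cos (real_of_int m * s)) * (2 * complex_of_real pi * q s ^ nat \<bar>n\<bar> / \<sigma> s) / a s" for m n s
  proof -
    have "integral {0..2 * pi} (\<lambda>t. character_pair m n (s, t) / grid_symbol \<alpha> \<beta> (s, t)) =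
      integral {0..2 * pi} (\<lambda>t. complex_of_real (cos (real_of_int m * s)) / a s *
        (complex_of_real (cos (real (nat \<bar>n\<bar>) * t)) / (1 - w s * complex_of_real (cos t))))"
      by (intro integral_cong) (simp add: sym character_pair_def cos_int_abs[of n])
    also have "\<dots> = complex_of_real (cos (real_of_int m * s)) / a s * (2 * complex_of_real pi * q s ^ nat \<bar>n\<bar> / \<sigma> s)"
      unfolding integral_mult_right integral_cos_div_one_minus_cos[OF w_nz] \<sigma>_def q_def ..
    finally show ?thesis by simp
  qed
  obtain B where B: "\<And>s. s \<in> {0..2 * pi} \<Longrightarrow> cmod (2 * complex_of_real pi / (\<sigma> s * a s)) \<le> B"
  proof (rule continuous_on_interval_bounded)
    show "continuous_on {0..2 * pi} (\<lambda>s. 2 * complex_of_real pi / (\<sigma> s * a s))"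
      by (intro continuous_intros cont_\<sigma> cont_a) (use a_nz J in auto)
  qed (rule that)
  \<comment> \<open>Each q(s) lies in the open unit disc; attaining the maximum on a compact
    interval gives a single ratio below 1.\<close>
  have "\<exists>s\<in>{0..2 * pi}. \<forall>t\<in>{0..2 * pi}. cmod (q t) \<le> cmod (q s)"
    by (intro continuous_attains_sup continuous_intros cont_q) auto
  then obtain s0 where s0: "\<And>t. t \<in> {0..2 * pi} \<Longrightarrow> cmod (q t) \<le> cmod (q s0)"
    by blast
  show ?thesis
  proof (rule that[of "cmod (q s0)" "B * (2 * pi) / (2 * pi)\<^sup>2"])
    fix m n :: int
    define h where "h s = complex_of_real (cos (real_of_int m * s)) * (2 * complex_of_real pi * q s ^ nat \<bar>n\<bar> / \<sigma> s) / a s" for s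
    have "green \<alpha> \<beta> (m, n) = 1 / (2 * complex_of_real pi)\<^sup>2 * integral {0..2 * pi} h"
      by (simp add: green_def torus_mean_iterated[OF continuous_on_green_integrand] inner h_def[abs_def])
    then have "cmod (green \<alpha> \<beta> (m, n)) = cmod (integral {0..2 * pi} h) / (2 * pi)\<^sup>2"
      by (simp add: norm_divide norm_mult norm_power)
    also have "\<dots> \<le> (B * cmod (q s0) ^ nat \<bar>n\<bar> * (2 * pi - 0)) / (2 * pi)\<^sup>2"
    proof (intro divide_right_mono integral_bound)
      show "continuous_on {0..2 * pi} h"
        unfolding h_def by (intro continuous_intros cont_q cont_\<sigma> cont_a) (use J a_nz in auto)
      fix s assume s: "s \<in> {0..2 * pi}"
      have "cmod (h s) = \<bar>cos (real_of_int m * s)\<bar> * (cmod (2 * complex_of_real pi / (\<sigma> s * a s)) * cmod (q s) ^ nat \<bar>n\<bar>)"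
        by (simp add: h_def norm_mult norm_divide norm_power)
      also have "\<dots> \<le> 1 * (B * cmod (q s0) ^ nat \<bar>n\<bar>)"
        using B[OF s] s0[OF s] by (intro mult_mono power_mono) (auto intro: order_trans[OF norm_ge_zero])
      finally show "cmod (h s) \<le> B * cmod (q s0) ^ nat \<bar>n\<bar>" by simp
    qed simp_all
    also have "\<dots> = B * (2 * pi) / (2 * pi)\<^sup>2 * cmod (q s0) ^ nat \<bar>n\<bar>"
      by (simp add: mult_ac)
    finally show "cmod (green \<alpha> \<beta> (m, n)) \<le> B * (2 * pi) / (2 * pi)\<^sup>2 * cmod (q s0) ^ nat \<bar>n\<bar>" .
  qed (use J in auto)
qed

end

lemma summable_on_power_abs_int:
  fixes r :: real
  assumes "0 \<le> r" "r < 1"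
  shows "(\<lambda>m::int. r ^ nat \<bar>m\<bar>) summable_on UNIV"
proof -
  have geo: "(\<lambda>n::nat. r ^ n) summable_on UNIV"
    using assms by (intro norm_summable_imp_summable_on) (simp add: summable_geometric)
  have "(\<lambda>m::int. r ^ nat \<bar>m\<bar>) summable_on range int"
    by (subst summable_on_reindex) (auto simp: o_def geo)
  moreover have "(\<lambda>m::int. r ^ nat \<bar>m\<bar>) summable_on range (\<lambda>n. - int n)"
    by (subst summable_on_reindex) (auto simp: o_def geo inj_on_def)
  moreover have "(UNIV :: int set) = range int \<union> range (\<lambda>n. - int n)"
    by (metis (no_types, lifting) UNIV_eq_I UnI1 UnI2 int_cases2 rangeI)
  ultimately show ?thesis
    by (metis summable_on_union)
qed

lemma summable_on_power_abs_grid: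
  fixes r :: real
  assumes "0 \<le> r" "r < 1"
  shows "(\<lambda>x::int \<times> int. r ^ nat \<bar>fst x\<bar> * r ^ nat \<bar>snd x\<bar>) summable_on UNIV"
proof -
  note sum = summable_on_power_abs_int[OF assms]
  have "(\<lambda>x::int \<times> int. r ^ nat \<bar>fst x\<bar> * r ^ nat \<bar>snd x\<bar>) summable_on (UNIV \<times> UNIV)"
    by (rule summable_on_SigmaI[where g = "\<lambda>m. r ^ nat \<bar>m\<bar> * (\<Sum>\<^sub>\<infinity>n. r ^ nat \<bar>n::int\<bar>)"])
      (use assms sum in \<open>auto intro!: has_sum_cmult_right summable_on_cmult_left\<close>)
  then show ?thesis by simp
qed

text \<open>By symmetry the decay in one coordinate also holds in the other. The product of the two
  bounds controls the square of the Green function, so decay in both coordinates follows with ratio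
  \<open>sqrt \<rho>\<close>.\<close>

lemma summable_green:
  assumes nz: "\<And>p. grid_symbol \<alpha> \<beta> p \<noteq> 0"
  shows "(\<lambda>x. cmod (green \<alpha> \<beta> x)) summable_on UNIV"
proof -
  obtain K \<rho> where \<rho>: "0 \<le> \<rho>" "\<rho> < 1" and K: "\<And>m n. cmod (green \<alpha> \<beta> (m, n)) \<le> K * \<rho> ^ nat \<bar>n\<bar>"
    using green_decay[OF nz] by metis
  have "K \<ge> 0"
    using order_trans[OF norm_ge_zero K[of 0 0]] by simp
  define r where "r = sqrt \<rho>"
  have r: "0 \<le> r" "r < 1" "\<rho> = r\<^sup>2"
    using \<rho> by (auto simp: r_def)
  have r_pow: "\<rho> ^ k = (r ^ k)\<^sup>2" for k
    by (simp add: r(3) mult.commute flip: power_mult)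
  have "cmod (green \<alpha> \<beta> (m, n)) \<le> K * (r ^ nat \<bar>m\<bar> * r ^ nat \<bar>n\<bar>)" for m n
  proof (rule power2_le_imp_le)
    have "(cmod (green \<alpha> \<beta> (m, n)))\<^sup>2 = cmod (green \<alpha> \<beta> (m, n)) * cmod (green \<alpha> \<beta> (n, m))"
      by (subst (2) green_commute[OF nz]) (simp add: power2_eq_square)
    also have "\<dots> \<le> (K * \<rho> ^ nat \<bar>n\<bar>) * (K * \<rho> ^ nat \<bar>m\<bar>)"
      using \<open>K \<ge> 0\<close> \<rho> by (intro mult_mono K) auto
    also have "\<dots> = (K * (r ^ nat \<bar>m\<bar> * r ^ nat \<bar>n\<bar>))\<^sup>2"
      unfolding r_pow by (simp add: power2_eq_square mult_ac)
    finally show "(cmod (green \<alpha> \<beta> (m, n)))\<^sup>2 \<le> (K * (r ^ nat \<bar>m\<bar> * r ^ nat \<bar>n\<bar>))\<^sup>2" .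
  qed (use \<open>K \<ge> 0\<close> r in auto)
  then have "cmod (green \<alpha> \<beta> x) \<le> K * (r ^ nat \<bar>fst x\<bar> * r ^ nat \<bar>snd x\<bar>)" for x
    by (cases x) simp
  then show ?thesis
    by (intro Infinite_Sum.abs_summable_on_comparison_test'
        [OF summable_on_cmult_right[OF summable_on_power_abs_grid[OF r(1,2)]]]) auto
qed

section \<open>Spectrum and resolvent trace\<close>

lemma l2norm_nonneg: "l2norm f \<ge> 0"
  by (simp add: l2norm_def infsum_nonneg)

lemma l2norm_mono:
  assumes f: "f \<in> l2" and le: "\<And>x. cmod (g x) \<le> c * cmod (f x)" and "c \<ge> 0"
  shows "l2norm g \<le> c * l2norm f"
proof -
  have sum: "(\<lambda>x. c\<^sup>2 * (cmod (f x))\<^sup>2) summable_on UNIV"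
    using f by (intro summable_on_cmult_right) (simp add: l2_def)
  have sq: "(cmod (g x))\<^sup>2 \<le> c\<^sup>2 * (cmod (f x))\<^sup>2" for x
    using power_mono[OF le, of x 2] by (simp add: power_mult_distrib)
  have "(\<lambda>x. (cmod (g x))\<^sup>2) summable_on UNIV"
    by (rule summable_on_comparison_test[OF sum]) (use sq in auto)
  then have "(\<Sum>\<^sub>\<infinity>x. (cmod (g x))\<^sup>2) \<le> (\<Sum>\<^sub>\<infinity>x. c\<^sup>2 * (cmod (f x))\<^sup>2)"
    by (rule infsum_mono[OF _ sum]) (use sq in auto)
  also have "\<dots> = c\<^sup>2 * (\<Sum>\<^sub>\<infinity>x. (cmod (f x))\<^sup>2)"
    by (rule infsum_cmult_right')
  finally have "l2norm g \<le> sqrt (c\<^sup>2 * (\<Sum>\<^sub>\<infinity>x. (cmod (f x))\<^sup>2))"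
    unfolding l2norm_def by (rule real_sqrt_le_mono)
  then show ?thesis
    using \<open>c \<ge> 0\<close> by (simp add: l2norm_def real_sqrt_mult)
qed

text \<open>A step away from the origin multiplies by r, a step towards it by 1/r. The second change
  is the larger one, because 1 - r <= (1 - r) / r.\<close>

lemma power_abs_neighbour:
  fixes r :: real and m d :: int
  assumes r: "0 < r" "r < 1" and d: "\<bar>d\<bar> = 1"
  shows "\<bar>r ^ nat \<bar>m + d\<bar> - r ^ nat \<bar>m\<bar>\<bar> \<le> (1 / r - 1) * r ^ nat \<bar>m\<bar>"
proof -
  have "1 - r \<le> (1 - r) / r"
    using r by (simp add: pos_le_divide_eq mult_left_le)
  then have le: "1 - r \<le> 1 / r - 1"
    using r by (simp add: diff_divide_distrib)
  consider "nat \<bar>m + d\<bar> = Suc (nat \<bar>m\<bar>)" | "nat \<bar>m\<bar> = Suc (nat \<bar>m + d\<bar>)"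
    using d by linarith
  then show ?thesis
  proof cases
    case 1
    have "\<bar>r * r ^ nat \<bar>m\<bar> - r ^ nat \<bar>m\<bar>\<bar> = (1 - r) * r ^ nat \<bar>m\<bar>"
      using r mult_right_mono[of r 1 "r ^ nat \<bar>m\<bar>"] by (simp add: abs_if algebra_simps)
    also have "\<dots> \<le> (1 / r - 1) * r ^ nat \<bar>m\<bar>"
      using le r by (intro mult_right_mono) auto
    finally show ?thesis
      using 1 by simp
  next
    case 2
    have "\<bar>r ^ nat \<bar>m + d\<bar> - r * r ^ nat \<bar>m + d\<bar>\<bar> = (1 - r) * r ^ nat \<bar>m + d\<bar>"
      using r mult_right_mono[of r 1 "r ^ nat \<bar>m + d\<bar>"] by (simp add: abs_if algebra_simps)
    also have "\<dots> = (1 / r - 1) * (r * r ^ nat \<bar>m + d\<bar>)"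
      using r by (simp add: field_simps)
    finally show ?thesis
      using 2 by simp
  qed
qed

text \<open>
  For exponentially damped characters the error of the eigenvalue equation is pointwise
  proportional to the vector itself.
\<close>

lemma grid_op_not_bounded_below:
  assumes zero: "grid_symbol \<alpha> \<beta> p = 0"
  shows "\<not> (\<exists>C. \<forall>f\<in>l2. l2norm f \<le> C * l2norm (grid_op \<alpha> \<beta> f))"
proof
  assume "\<exists>C. \<forall>f\<in>l2. l2norm f \<le> C * l2norm (grid_op \<alpha> \<beta> f)"
  then obtain C where C: "\<And>f. f \<in> l2 \<Longrightarrow> l2norm f \<le> C * l2norm (grid_op \<alpha> \<beta> f)"
    by blast
  obtain s t where p: "p = (s, t)" by fastforce
  \<comment> \<open>Chosen so that four neighbour errors of relative size \<eta>, multiplied by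
    |\<beta>| and |C|, stay below 1; the summand 1 protects against a zero denominator. The next
    choice of r makes 1/r - 1 equal to \<eta>.\<close>
  define \<eta> where "\<eta> = 1 / (8 * (\<bar>C\<bar> * cmod \<beta> + 1))"
  define r where "r = 1 / (1 + \<eta>)"
  have \<eta>: "\<eta> > 0"
    by (auto simp: \<eta>_def intro!: divide_pos_pos add_nonneg_pos)
  then have r: "0 < r" "r < 1" "1 / r - 1 = \<eta>"
    by (auto simp: r_def)
  define c where "c x = cis (real_of_int (fst x) * s + real_of_int (snd x) * t)" for x :: "int \<times> int"
  define b where "b x = r ^ nat \<bar>fst x\<bar> * r ^ nat \<bar>snd x\<bar>" for x :: "int \<times> int"
  define f where "f x = complex_of_real (b x) * c x" for x
  have b: "b x \<ge> 0" for x
    using r by (simp add: b_def)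
  have norm_c: "cmod (c x) = 1" for x
    by (simp add: c_def)
  have norm_f: "cmod (f x) = b x" for x
    using b by (simp add: f_def norm_mult norm_c)
  have "(\<lambda>x::int \<times> int. (r\<^sup>2) ^ nat \<bar>fst x\<bar> * (r\<^sup>2) ^ nat \<bar>snd x\<bar>) summable_on UNIV"
    using r by (intro summable_on_power_abs_grid) (auto simp: power_less_one_iff)
  moreover have "(cmod (f x))\<^sup>2 = (r\<^sup>2) ^ nat \<bar>fst x\<bar> * (r\<^sup>2) ^ nat \<bar>snd x\<bar>" for x
    unfolding norm_f b_def by (simp add: power_mult_distrib mult.commute flip: power_mult)
  ultimately have f: "f \<in> l2"
    by (simp add: l2_def)
  have c_add: "c (x + y) = c x * c y" for x y
    by (simp add: c_def cis_mult algebra_simps)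
  have nb: "cmod (f (x + d) - c d * f x) \<le> \<eta> * cmod (f x)"
    if "d \<in> {(1, 0), (- 1, 0), (0, 1), (0, - 1)}" for x d
  proof -
    have "f (x + d) - c d * f x = complex_of_real (b (x + d) - b x) * (c x * c d)"
      by (simp add: f_def c_add algebra_simps)
    then have "cmod (f (x + d) - c d * f x) = \<bar>b (x + d) - b x\<bar>"
      by (simp add: norm_mult norm_c del: of_real_diff)
    also have "\<dots> \<le> \<eta> * b x"
    proof (cases "snd d = 0")
      case True
      then have "\<bar>b (x + d) - b x\<bar> = \<bar>r ^ nat \<bar>fst x + fst d\<bar> - r ^ nat \<bar>fst x\<bar>\<bar> * r ^ nat \<bar>snd x\<bar>"
        using r by (simp add: b_def abs_mult flip: left_diff_distrib)
      also have "\<dots> \<le> ((1 / r - 1) * r ^ nat \<bar>fst x\<bar>) * r ^ nat \<bar>snd x\<bar>"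
        using r True that by (intro mult_right_mono power_abs_neighbour) auto
      finally show ?thesis
        unfolding r(3) by (simp add: b_def mult.assoc)
    next
      case False
      then have "\<bar>b (x + d) - b x\<bar> = r ^ nat \<bar>fst x\<bar> * \<bar>r ^ nat \<bar>snd x + snd d\<bar> - r ^ nat \<bar>snd x\<bar>\<bar>"
        using r that by (auto simp: b_def abs_mult simp flip: right_diff_distrib)
      also have "\<dots> \<le> r ^ nat \<bar>fst x\<bar> * ((1 / r - 1) * r ^ nat \<bar>snd x\<bar>)"
        using r False that by (intro mult_left_mono power_abs_neighbour) auto
      finally show ?thesis
        unfolding r(3) by (simp add: b_def mult_ac)
    qed
    finally show ?thesis
      by (simp add: norm_f)
  qed
  define E where "E d x = f (x + d) - c d * f x" for d x
  \<comment> \<open>The zero of the symbol says that the undamped character c is annihilated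
    exactly. Only the errors E of the damping survive below.\<close>
  have "\<alpha> = \<beta> * (c (- 1, 0) + c (1, 0) + c (0, - 1) + c (0, 1))"
    using zero by (simp add: c_def p grid_symbol_def complex_eq_iff)
  then have "grid_op \<alpha> \<beta> f x = - \<beta> * (E (- 1, 0) x + E (1, 0) x + E (0, - 1) x + E (0, 1) x)" for x
    by (simp add: grid_op_def adjacency_def translate_def E_def algebra_simps)
  moreover have "cmod (E (- 1, 0) x + E (1, 0) x + E (0, - 1) x + E (0, 1) x) \<le> 4 * (\<eta> * cmod (f x))" for x
    using nb[of "(- 1, 0)" x] nb[of "(1, 0)" x] nb[of "(0, - 1)" x] nb[of "(0, 1)" x]
      norm_triangle_ineq[of "E (- 1, 0) x + E (1, 0) x + E (0, - 1) x" "E (0, 1) x"]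
      norm_triangle_ineq[of "E (- 1, 0) x + E (1, 0) x" "E (0, - 1) x"]
      norm_triangle_ineq[of "E (- 1, 0) x" "E (1, 0) x"]
    by (simp add: E_def)
  ultimately have "cmod (grid_op \<alpha> \<beta> f x) \<le> (cmod \<beta> * (4 * \<eta>)) * cmod (f x)" for x
    by (simp add: norm_mult mult_left_mono mult.assoc)
  then have "l2norm (grid_op \<alpha> \<beta> f) \<le> (cmod \<beta> * (4 * \<eta>)) * l2norm f"
    using f \<eta> by (intro l2norm_mono) auto
  then have "\<bar>C\<bar> * l2norm (grid_op \<alpha> \<beta> f) \<le> \<bar>C\<bar> * ((cmod \<beta> * (4 * \<eta>)) * l2norm f)"
    by (rule mult_left_mono) simp
  moreover have "l2norm f \<le> \<bar>C\<bar> * l2norm (grid_op \<alpha> \<beta> f)"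
    by (rule order_trans[OF C[OF f] mult_right_mono[OF abs_ge_self l2norm_nonneg]])
  ultimately have "l2norm f \<le> (\<bar>C\<bar> * cmod \<beta> * (4 * \<eta>)) * l2norm f"
    by (simp add: mult.assoc)
  moreover have "l2norm f > 0"
    using cmod_le_l2norm[OF f, of "(0, 0)"] by (simp add: norm_f b_def)
  ultimately have "1 \<le> \<bar>C\<bar> * cmod \<beta> * (4 * \<eta>)"
    by simp
  moreover have "\<bar>C\<bar> * cmod \<beta> * (4 * \<eta>) < 1"
    by (simp add: \<eta>_def divide_less_eq add_nonneg_pos)
  ultimately show False
    by simp
qed

section \<open>Spectrum and resolvent of \<open>Delta u\<close> in terms of its symbol\<close>

abbreviation Delta_symbol :: "complex \<Rightarrow> real \<times> real \<Rightarrow> complex" where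
  "Delta_symbol u \<equiv> grid_symbol (1 + 3 * u\<^sup>2) u"

lemma grid_symbol_shifted: "grid_symbol (z - 1 - 3 * u\<^sup>2) (- u) p = z - Delta_symbol u p"
  by (simp add: grid_symbol_def algebra_simps)

text \<open>A zero-free shifted symbol has a summable Green function and hence a bounded inverse. At
  a zero the operator is not bounded below, which already violates the second clause of the
  definition of the spectrum.\<close>

lemma spectrum_Delta: "spectrum_l2 (Delta u) = range (Delta_symbol u)"
proof (intro set_eqI iffI)
  fix z assume "z \<in> spectrum_l2 (Delta u)"
  then have "\<exists>p. grid_symbol (z - 1 - 3 * u\<^sup>2) (- u) p = 0"
    unfolding spectrum_l2_def shifted_Delta mem_Collect_eq
    using grid_op_inverse(1,2)[OF summable_green grid_op_green] by blast
  then show "z \<in> range (Delta_symbol u)"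
    by (auto simp: grid_symbol_shifted)
next
  fix z assume "z \<in> range (Delta_symbol u)"
  then obtain p where "grid_symbol (z - 1 - 3 * u\<^sup>2) (- u) p = 0"
    by (auto simp: grid_symbol_shifted)
  then show "z \<in> spectrum_l2 (Delta u)"
    unfolding spectrum_l2_def shifted_Delta mem_Collect_eq
    using grid_op_not_bounded_below by blast
qed

text \<open>The inverse applied to \<open>delta_id\<close> is the Green function, and at the origin
  the character is identically 1.\<close>

lemma resolvent_Delta_trace:
  assumes "z \<notin> range (Delta_symbol u)"
  shows "resolvent_l2 (Delta u) z delta_id 0 = torus_mean (\<lambda>p. 1 / (z - Delta_symbol u p))"
proof -
  have nz: "grid_symbol (z - 1 - 3 * u\<^sup>2) (- u) p \<noteq> 0" for p
    using assms by (auto simp: grid_symbol_shifted)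
  show ?thesis
    unfolding resolvent_l2_def shifted_Delta
      grid_op_inverse(3)[OF summable_green[OF nz] grid_op_green[OF nz]]
    by (simp add: green_def character_pair_def grid_symbol_shifted)
qed

section \<open>The logarithm by the functional calculus\<close>

lemma has_contour_integral_inverse_circlepath:
  assumes "cmod a < R"
  shows "((\<lambda>w. 1 / (w - a)) has_contour_integral (2 * complex_of_real pi * \<i>)) (circlepath 0 R)"
  using Cauchy_integral_circlepath_simple[of "\<lambda>_. 1" 0 R a] assms by simp

text \<open>
  The path is an ellipse with foci \<open>c \<plusminus> 2 d\<close>, tending to the segment between them as \<open>R\<close> tends to 1.
\<close>

lemma joukowski_ellipse:
  fixes c d :: complex and R :: real
  assumes "d \<noteq> 0" "R > 1"
  defines "\<gamma> \<equiv> (\<lambda>\<zeta>. c + d * (\<zeta> + 1 / \<zeta>)) \<circ> circlepath 0 R"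
  shows "valid_path \<gamma>" "pathfinish \<gamma> = pathstart \<gamma>"
    and "c + 2 * d * complex_of_real (cos \<theta>) \<notin> path_image \<gamma>"
    and "winding_number \<gamma> (c + 2 * d * complex_of_real (cos \<theta>)) = 1"
    and "z \<in> path_image \<gamma> \<Longrightarrow> \<exists>\<phi>. dist (c + 2 * d * complex_of_real (cos \<phi>)) z \<le> 2 * cmod d * (R - 1)"
proof -
  define J where "J \<zeta> = c + d * (\<zeta> + 1 / \<zeta>)" for \<zeta> :: complex
  have \<gamma>: "\<gamma> = J \<circ> circlepath 0 R"
    by (simp add: \<gamma>_def J_def[abs_def])
  have hol: "J holomorphic_on - {0}"
    unfolding J_def by (intro holomorphic_intros) auto
  have img: "path_image (circlepath 0 R) = sphere 0 R"
    using \<open>R > 1\<close> by simp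
  have img_nz: "path_image (circlepath 0 R) \<subseteq> - {0}"
    using \<open>R > 1\<close> unfolding img by auto
  show valid: "valid_path \<gamma>"
    unfolding \<gamma> by (rule valid_path_compose_holomorphic[OF valid_path_circlepath hol _ img_nz]) auto
  show "pathfinish \<gamma> = pathstart \<gamma>"
    unfolding \<gamma> by (simp add: pathfinish_compose pathstart_compose)
  define e where "e = cis \<theta>"
  define e' where "e' = cis (- \<theta>)"
  define z0 where "z0 = c + 2 * d * complex_of_real (cos \<theta>)"
  have ee: "e * e' = 1" "e + e' = 2 * complex_of_real (cos \<theta>)"
    by (simp_all add: e_def e'_def cis_mult complex_eq_iff)
  have J_diff: "J \<zeta> - z0 = d * ((\<zeta> - e) * (\<zeta> - e')) / \<zeta>" if "\<zeta> \<noteq> 0" for \<zeta>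
  proof -
    have prod: "(\<zeta> - e) * (\<zeta> - e') = \<zeta> * \<zeta> - \<zeta> * (2 * complex_of_real (cos \<theta>)) + 1"
      unfolding ee[symmetric] by (simp add: algebra_simps)
    show ?thesis
      unfolding prod z0_def J_def using that by (simp add: field_simps)
  qed
  have nz: "\<zeta> \<noteq> 0" "\<zeta> - e \<noteq> 0" "\<zeta> - e' \<noteq> 0" if "\<zeta> \<in> sphere 0 R" for \<zeta>
    using that \<open>R > 1\<close> by (auto simp: e_def e'_def)
  have partial_fractions: "(x * b + x * a - a * b) / (x * (a * b)) = 1 / a + 1 / b - 1 / x"
    if "x \<noteq> 0" "a \<noteq> 0" "b \<noteq> 0" for x a b :: complex
    using that by (simp add: divide_simps) (simp add: algebra_simps)
  have J_ne: "J \<zeta> \<noteq> z0" if "\<zeta> \<in> sphere 0 R" for \<zeta>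
    using J_diff[of \<zeta>] nz[OF that] \<open>d \<noteq> 0\<close> by auto
  then have notin: "z0 \<notin> path_image \<gamma>"
    unfolding \<gamma> path_image_compose img by blast
  then show "c + 2 * d * complex_of_real (cos \<theta>) \<notin> path_image \<gamma>"
    by (simp add: z0_def)
  \<comment> \<open>Pulled back to the circle, the integrand is the logarithmic derivative of J -
    z0, which has the two zeros e and e' and the pole 0 inside. The count is 1 + 1 - 1 = 1.\<close>
  have "contour_integral \<gamma> (\<lambda>w. 1 / (w - z0)) = contour_integral (circlepath 0 R) (\<lambda>\<zeta>. deriv J \<zeta> * (1 / (J \<zeta> - z0)))"
    unfolding \<gamma> using hol img_nz
    by (intro contour_integral_comp_analyticW[of J "- {0}"] valid_path_circlepath) (simp_all add: analytic_on_open open_Compl)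
  also have "\<dots> = contour_integral (circlepath 0 R) (\<lambda>\<zeta>. 1 / (\<zeta> - e) + 1 / (\<zeta> - e') - 1 / (\<zeta> - 0))"
  proof (rule contour_integral_eq)
    fix \<zeta> assume "\<zeta> \<in> path_image (circlepath 0 R)"
    then have \<zeta>: "\<zeta> \<in> sphere 0 R"
      unfolding img .
    note nz' = nz[OF \<zeta>]
    have "(J has_field_derivative d * (1 - 1 / \<zeta>\<^sup>2)) (at \<zeta>)"
      unfolding J_def using nz'(1) by (auto intro!: derivative_eq_intros simp: power2_eq_square)
    then have "deriv J \<zeta> * (1 / (J \<zeta> - z0)) = d * (1 - 1 / \<zeta>\<^sup>2) * (\<zeta> / (d * ((\<zeta> - e) * (\<zeta> - e'))))"
      using nz' by (simp add: DERIV_imp_deriv J_diff)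
    also have "\<dots> = (\<zeta> * \<zeta> - 1) / (\<zeta> * ((\<zeta> - e) * (\<zeta> - e')))"
      using nz' \<open>d \<noteq> 0\<close> by (simp add: divide_simps power2_eq_square)
    also have "\<zeta> * \<zeta> - 1 = \<zeta> * (\<zeta> - e') + \<zeta> * (\<zeta> - e) - (\<zeta> - e) * (\<zeta> - e')"
      unfolding ee(1)[symmetric] by (simp add: algebra_simps)
    also have "\<dots> / (\<zeta> * ((\<zeta> - e) * (\<zeta> - e'))) = 1 / (\<zeta> - e) + 1 / (\<zeta> - e') - 1 / (\<zeta> - 0)"
      using partial_fractions[OF nz'] by simp
    finally show "deriv J \<zeta> * (1 / (J \<zeta> - z0)) = 1 / (\<zeta> - e) + 1 / (\<zeta> - e') - 1 / (\<zeta> - 0)" .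
  qed
  also have "\<dots> = 2 * complex_of_real pi * \<i> + 2 * complex_of_real pi * \<i> - 2 * complex_of_real pi * \<i>"
    using \<open>R > 1\<close>
    by (intro contour_integral_unique has_contour_integral_add has_contour_integral_diff
        has_contour_integral_inverse_circlepath) (auto simp: e_def e'_def)
  finally have "winding_number \<gamma> z0 = 1"
    using winding_number_valid_path[OF valid notin] by simp
  then show "winding_number \<gamma> (c + 2 * d * complex_of_real (cos \<theta>)) = 1"
    by (simp add: z0_def)
  show "\<exists>\<phi>. dist (c + 2 * d * complex_of_real (cos \<phi>)) z \<le> 2 * cmod d * (R - 1)" if "z \<in> path_image \<gamma>"
  proof -
    obtain \<zeta> where \<zeta>: "cmod \<zeta> = R" "z = J \<zeta>"
      using \<open>z \<in> path_image \<gamma>\<close> unfolding \<gamma> path_image_compose img by auto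
    define \<phi> where "\<phi> = Arg \<zeta>"
    have \<zeta>_eq: "\<zeta> = complex_of_real R * cis \<phi>"
      using rcis_cmod_Arg[of \<zeta>] \<zeta> by (simp add: rcis_def \<phi>_def)
    have "1 / \<zeta> = complex_of_real (1 / R) * cis (- \<phi>)"
      unfolding \<zeta>_eq by (simp add: divide_inverse flip: cis_inverse)
    moreover have "2 * complex_of_real (cos \<phi>) = cis \<phi> + cis (- \<phi>)"
      by (simp add: complex_eq_iff)
    ultimately have "z - (c + 2 * d * complex_of_real (cos \<phi>))
        = d * (complex_of_real (R - 1) * cis \<phi> - complex_of_real (1 - 1 / R) * cis (- \<phi>))"
      unfolding \<zeta>(2) J_def by (simp add: \<zeta>_eq algebra_simps)
    then have "dist (c + 2 * d * complex_of_real (cos \<phi>)) z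
        = cmod d * cmod (complex_of_real (R - 1) * cis \<phi> - complex_of_real (1 - 1 / R) * cis (- \<phi>))"
      by (simp add: dist_norm norm_minus_commute norm_mult)
    \<comment> \<open>The point of the segment with the same angle is compared: the radii R and 1/R
      differ from 1 by R - 1 and 1 - 1/R.\<close>
    also have "\<dots> \<le> cmod d * ((R - 1) + (1 - 1 / R))"
    proof (rule mult_left_mono)
      have "cmod (complex_of_real (R - 1) * cis \<phi> - complex_of_real (1 - 1 / R) * cis (- \<phi>))
        \<le> cmod (complex_of_real (R - 1) * cis \<phi>) + cmod (complex_of_real (1 - 1 / R) * cis (- \<phi>))"
        by (rule norm_triangle_ineq4)
      also have "\<dots> = (R - 1) + (1 - 1 / R)"
        using \<open>R > 1\<close> by (simp add: norm_mult del: of_real_diff of_real_divide)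
      finally show "cmod (complex_of_real (R - 1) * cis \<phi> - complex_of_real (1 - 1 / R) * cis (- \<phi>))
        \<le> (R - 1) + (1 - 1 / R)" .
    qed simp
    also have "\<dots> \<le> cmod d * (2 * (R - 1))"
    proof (rule mult_left_mono)
      have "1 - 1 / R = (R - 1) / R"
        using \<open>R > 1\<close> by (simp add: diff_divide_distrib)
      also have "\<dots> \<le> R - 1"
        using \<open>R > 1\<close> by (simp add: divide_le_eq)
      finally show "(R - 1) + (1 - 1 / R) \<le> 2 * (R - 1)" by simp
    qed simp
    finally show ?thesis
      by (auto simp: mult_ac)
  qed
qed

lemma loop_near_segment:
  fixes c d :: complex
  assumes "\<epsilon> > 0"
  obtains \<gamma> where "valid_path \<gamma>" "pathfinish \<gamma> = pathstart \<gamma>"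
    "\<And>\<theta>. c + 2 * d * complex_of_real (cos \<theta>) \<notin> path_image \<gamma>"
    "\<And>\<theta>. winding_number \<gamma> (c + 2 * d * complex_of_real (cos \<theta>)) = 1"
    "\<And>z. z \<in> path_image \<gamma> \<Longrightarrow> \<exists>\<phi>. dist (c + 2 * d * complex_of_real (cos \<phi>)) z < \<epsilon>"
proof (cases "d = 0")
  \<comment> \<open>For d = 0 the segment is a single point and the ellipse would degenerate; for
    \<open>Delta u\<close> this is the case u = 0.\<close>
  case True
  show ?thesis
  proof (rule that[of "circlepath c (\<epsilon> / 2)"])
    show "winding_number (circlepath c (\<epsilon> / 2)) (c + 2 * d * complex_of_real (cos \<theta>)) = 1" for \<theta>
      using True \<open>\<epsilon> > 0\<close> by (intro winding_number_circlepath) auto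
  qed (use True \<open>\<epsilon> > 0\<close> in auto)
next
  case False
  \<comment> \<open>This makes the distance bound 2 |d| (R - 1) equal to half of \<epsilon>.\<close>
  define R where "R = 1 + \<epsilon> / (4 * cmod d)"
  have R: "R > 1" "2 * cmod d * (R - 1) < \<epsilon>"
    using False \<open>\<epsilon> > 0\<close> by (auto simp: R_def)
  show ?thesis
  proof (rule that[OF joukowski_ellipse(1-4)[OF False R(1)]])
    fix z assume "z \<in> path_image ((\<lambda>\<zeta>. c + d * (\<zeta> + 1 / \<zeta>)) \<circ> circlepath 0 R)"
    from joukowski_ellipse(5)[OF False R(1) this] R(2)
    show "\<exists>\<phi>. dist (c + 2 * d * complex_of_real (cos \<phi>)) z < \<epsilon>"
      by (meson le_less_trans)
  qed
qed

text \<open>The average of two cosines is again the cosine of some angle, and the diagonal s = t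
  already produces every value.\<close>

lemma range_Delta_symbol:
  "range (Delta_symbol u) = range (\<lambda>\<theta>. 1 + 3 * u\<^sup>2 + 2 * (- 2 * u) * complex_of_real (cos \<theta>))"
proof (intro equalityI subsetI)
  fix z assume "z \<in> range (Delta_symbol u)"
  then obtain s t where z: "z = Delta_symbol u (s, t)" by auto
  define y where "y = (cos s + cos t) / 2"
  have "- 1 \<le> y"
    using cos_ge_minus_one[of s] cos_ge_minus_one[of t] by (simp add: y_def del: cos_ge_minus_one)
  moreover have "y \<le> 1"
    using cos_le_one[of s] cos_le_one[of t] by (simp add: y_def del: cos_le_one)
  ultimately have eq: "complex_of_real (cos (arccos y)) = (complex_of_real (cos s) + complex_of_real (cos t)) / 2"
    by (simp add: cos_arccos) (simp add: y_def)
  have "z = 1 + 3 * u\<^sup>2 + 2 * (- 2 * u) * complex_of_real (cos (arccos y))"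
    unfolding eq by (simp add: z grid_symbol_def field_simps)
  then show "z \<in> range (\<lambda>\<theta>. 1 + 3 * u\<^sup>2 + 2 * (- 2 * u) * complex_of_real (cos \<theta>))" by blast
next
  fix z assume "z \<in> range (\<lambda>\<theta>. 1 + 3 * u\<^sup>2 + 2 * (- 2 * u) * complex_of_real (cos \<theta>))"
  then obtain \<theta> where "z = 1 + 3 * u\<^sup>2 + 2 * (- 2 * u) * complex_of_real (cos \<theta>)"
    by blast
  then have "z = Delta_symbol u (\<theta>, \<theta>)"
    by (simp add: grid_symbol_def)
  then show "z \<in> range (Delta_symbol u)" by blast
qed

lemma segment_eq_range_cos:
  fixes c d :: complex
  shows "range (\<lambda>\<theta>. c + 2 * d * complex_of_real (cos \<theta>)) = closed_segment (c - 2 * d) (c + 2 * d)"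
proof (intro equalityI subsetI)
  fix z assume "z \<in> range (\<lambda>\<theta>. c + 2 * d * complex_of_real (cos \<theta>))"
  then obtain \<theta> where z: "z = c + 2 * d * complex_of_real (cos \<theta>)" by blast
  have "z = (1 - (1 + cos \<theta>) / 2) *\<^sub>R (c - 2 * d) + ((1 + cos \<theta>) / 2) *\<^sub>R (c + 2 * d)"
    by (simp add: z scaleR_conv_of_real field_simps)
  moreover have "0 \<le> (1 + cos \<theta>) / 2"
    using cos_ge_minus_one[of \<theta>] by (simp del: cos_ge_minus_one)
  moreover have "(1 + cos \<theta>) / 2 \<le> 1"
    using cos_le_one[of \<theta>] by (simp del: cos_le_one)
  ultimately show "z \<in> closed_segment (c - 2 * d) (c + 2 * d)"
    unfolding in_segment by blast
next
  fix z assume "z \<in> closed_segment (c - 2 * d) (c + 2 * d)"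
  then obtain t where t: "0 \<le> t" "t \<le> 1" and z: "z = (1 - t) *\<^sub>R (c - 2 * d) + t *\<^sub>R (c + 2 * d)"
    unfolding in_segment by blast
  have eq: "cos (arccos (2 * t - 1)) = 2 * t - 1"
    using t by (intro cos_arccos) auto
  have "z = c + 2 * d * complex_of_real (cos (arccos (2 * t - 1)))"
    unfolding eq by (simp add: z scaleR_conv_of_real algebra_simps)
  then show "z \<in> range (\<lambda>\<theta>. c + 2 * d * complex_of_real (cos \<theta>))" by blast
qed

lemma compact_convex_range_Delta_symbol:
  "compact (range (Delta_symbol u))" "convex (range (Delta_symbol u))"
  unfolding range_Delta_symbol segment_eq_range_cos by simp_all

text \<open>The segment has positive distance \<epsilon> from the slit. A loop that stays within
  \<epsilon> of it lies in the neighbourhood V, which is convex and misses the slit, so the loop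
  does not wind around any point of the slit.\<close>

lemma log_contour_Delta_exists:
  assumes slit: "\<And>p. Delta_symbol u p \<notin> \<real>\<^sub>\<le>\<^sub>0"
  shows "\<exists>\<gamma>. log_contour (Delta u) \<gamma>"
proof -
  define S where "S = range (Delta_symbol u)"
  have S: "S = range (\<lambda>\<theta>. 1 + 3 * u\<^sup>2 + 2 * (- 2 * u) * complex_of_real (cos \<theta>))"
    unfolding S_def by (rule range_Delta_symbol)
  have "S \<inter> \<real>\<^sub>\<le>\<^sub>0 = {}"
    using slit by (auto simp: S_def)
  then obtain \<epsilon> where \<epsilon>: "\<epsilon> > 0" and sep: "\<And>x y. x \<in> S \<Longrightarrow> y \<in> \<real>\<^sub>\<le>\<^sub>0 \<Longrightarrow> \<epsilon> \<le> dist x y"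
    using separate_compact_closed[OF compact_convex_range_Delta_symbol(1)[of u] closed_nonpos_Reals_complex]
    unfolding S_def by blast
  obtain \<gamma> where \<gamma>: "valid_path \<gamma>" "pathfinish \<gamma> = pathstart \<gamma>"
    and off: "\<And>z. z \<in> S \<Longrightarrow> z \<notin> path_image \<gamma>"
    and wind: "\<And>z. z \<in> S \<Longrightarrow> winding_number \<gamma> z = 1"
    and near: "\<And>z. z \<in> path_image \<gamma> \<Longrightarrow> \<exists>x\<in>S. dist x z < \<epsilon>"
  proof (rule loop_near_segment[OF \<epsilon>, of "1 + 3 * u\<^sup>2" "- 2 * u"], rule that)
  qed (auto simp: S)
  define V where "V = (\<Union>x\<in>S. \<Union>y\<in>ball 0 \<epsilon>. {x + y})"
  have "convex V"
    unfolding V_def by (intro convex_sums convex_ball) (simp add: S_def compact_convex_range_Delta_symbol)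
  have img: "path_image \<gamma> \<subseteq> V"
  proof
    fix z assume "z \<in> path_image \<gamma>"
    then obtain x where "x \<in> S" "dist x z < \<epsilon>"
      using near by blast
    then show "z \<in> V"
      unfolding V_def by (intro UN_I[of x] UN_I[of "z - x"]) (auto simp: dist_norm norm_minus_commute)
  qed
  have V: "z \<notin> V" if "z \<in> \<real>\<^sub>\<le>\<^sub>0" for z
    using sep[OF _ that] by (fastforce simp: V_def dist_norm)
  have "winding_number \<gamma> z = 0" if "z \<in> \<real>\<^sub>\<le>\<^sub>0" for z
    by (rule winding_number_zero_outside[OF valid_path_imp_path[OF \<gamma>(1)] \<open>convex V\<close> \<gamma>(2) V[OF that] img])
  then have "log_contour (Delta u) \<gamma>"
    unfolding log_contour_def spectrum_Delta S_def[symmetric] using \<gamma> off wind V img by blast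
  then show ?thesis by blast
qed

section \<open>Holomorphic torus means and the interchange with contour integrals\<close>

lemma torus_mean_has_field_derivative:
  fixes f f' :: "complex \<Rightarrow> real \<times> real \<Rightarrow> complex"
  assumes "open U" "x0 \<in> U"
    and deriv: "\<And>x p. x \<in> U \<Longrightarrow> ((\<lambda>x. f x p) has_field_derivative f' x p) (at x)"
    and cont: "\<And>x. x \<in> U \<Longrightarrow> continuous_on torus (f x)"
    and cont': "continuous_on (U \<times> torus) (\<lambda>(x, p). f' x p)"
  shows "((\<lambda>x. torus_mean (f x)) has_field_derivative torus_mean (f' x0)) (at x0)"
proof -
  \<comment> \<open>The Leibniz rule is applied on a ball, which is a convex parameter set.\<close>
  obtain e where e: "e > 0" "ball x0 e \<subseteq> U"
    using assms open_contains_ball by blast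
  have "((\<lambda>x. integral (cbox (0, 0) (2 * pi, 2 * pi)) (f x)) has_field_derivative
      integral (cbox (0, 0) (2 * pi, 2 * pi)) (f' x0)) (at x0 within ball x0 e)"
  proof (rule leibniz_rule_field_derivative[where f = f and fx = f' and U = "ball x0 e"])
    show "((\<lambda>x. f x p) has_field_derivative f' x p) (at x within ball x0 e)" if "x \<in> ball x0 e" for x p
      using deriv[of x p] that e(2) by (blast intro: has_field_derivative_at_within)
    show "f x integrable_on cbox (0, 0) (2 * pi, 2 * pi)" if "x \<in> ball x0 e" for x
      unfolding torus_def[symmetric] using cont that e(2) by (blast intro: integrable_on_torus)
    show "continuous_on (ball x0 e \<times> cbox (0, 0) (2 * pi, 2 * pi)) (\<lambda>(x, p). f' x p)"
      unfolding torus_def[symmetric] using e(2) by (blast intro: continuous_on_subset[OF cont'])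
  qed (use e(1) in simp_all)
  then have "((\<lambda>x. integral torus (f x)) has_field_derivative integral torus (f' x0)) (at x0)"
    using e(1) by (simp add: at_within_open[of x0 "ball x0 e"] torus_def)
  then show ?thesis
    unfolding torus_mean_def by (rule DERIV_cmult)
qed

lemma continuous_on_grid_symbol_compose [continuous_intros]:
  fixes A :: "'a :: t2_space set"
  assumes "continuous_on A g" "continuous_on A a" "continuous_on A b"
  shows "continuous_on A (\<lambda>x. grid_symbol (a x) (b x) (g x))"
  unfolding grid_symbol_def using assms by (intro continuous_intros)

text \<open>Holomorphy off the spectrum makes the averaged resolvent an admissible integrand when
  the contour is replaced by a nearby one.\<close>

lemma holomorphic_resolvent_trace:
  "(\<lambda>z. torus_mean (\<lambda>p. 1 / (z - Delta_symbol u p))) holomorphic_on - range (Delta_symbol u)"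
proof -
  define U where "U = - range (Delta_symbol u)"
  have "open U"
    unfolding U_def by (intro open_Compl compact_imp_closed compact_convex_range_Delta_symbol)
  have nz: "z - Delta_symbol u p \<noteq> 0" if "z \<in> U" for z p
    using that by (auto simp: U_def)
  have "((\<lambda>z. torus_mean (\<lambda>p. 1 / (z - Delta_symbol u p))) has_field_derivative
      torus_mean (\<lambda>p. - 1 / (z - Delta_symbol u p)\<^sup>2)) (at z)" if "z \<in> U" for z
  proof (rule torus_mean_has_field_derivative[OF \<open>open U\<close> that])
    show "((\<lambda>z. 1 / (z - Delta_symbol u p)) has_field_derivative - 1 / (z - Delta_symbol u p)\<^sup>2) (at z)"
      if "z \<in> U" for z p
      using nz[OF that, of p] by (auto intro!: derivative_eq_intros simp: power2_eq_square)
    show "continuous_on torus (\<lambda>p. 1 / (z - Delta_symbol u p))" if "z \<in> U" for z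
      using nz[OF that] by (intro continuous_intros) auto
    show "continuous_on (U \<times> torus) (\<lambda>(z, p). - 1 / (z - Delta_symbol u p)\<^sup>2)"
      unfolding case_prod_unfold by (intro continuous_intros) (use nz in auto)
  qed
  then show ?thesis
    using \<open>open U\<close> unfolding U_def[symmetric] holomorphic_on_def
    by (meson field_differentiable_at_within field_differentiable_def)
qed

text \<open>
  A valid path need not be rectifiable, so Fubini does not apply to an arbitrary log contour.
  As all integrands are holomorphic off the spectrum and the slit, the contour may be replaced
  by a nearby polynomial loop.
\<close>

lemma smooth_log_contour:
  assumes \<gamma>: "log_contour (Delta u) \<gamma>"
  obtains h where "polynomial_function h" "log_contour (Delta u) h"
    "\<And>f. f holomorphic_on - \<real>\<^sub>\<le>\<^sub>0 - range (Delta_symbol u) \<Longrightarrow> contour_integral h f = contour_integral \<gamma> f"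
proof -
  define U where "U = - \<real>\<^sub>\<le>\<^sub>0 - range (Delta_symbol u)"
  have "open U"
    unfolding U_def by (intro open_Diff open_Compl closed_nonpos_Reals_complex compact_imp_closed
        compact_convex_range_Delta_symbol)
  have valid: "valid_path \<gamma>" and loop: "pathfinish \<gamma> = pathstart \<gamma>" and img: "path_image \<gamma> \<subseteq> U"
    and wind: "\<And>z. z \<in> range (Delta_symbol u) \<Longrightarrow> winding_number \<gamma> z = 1"
      "\<And>z. z \<in> \<real>\<^sub>\<le>\<^sub>0 \<Longrightarrow> winding_number \<gamma> z = 0"
    using \<gamma> unfolding log_contour_def spectrum_Delta U_def by auto
  obtain \<delta> where \<delta>: "\<delta> > 0" and near: "\<And>h. valid_path h \<Longrightarrow> (\<forall>t\<in>{0..1}. cmod (h t - \<gamma> t) < \<delta>) \<Longrightarrow>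
      pathfinish h = pathstart h \<Longrightarrow>
      path_image h \<subseteq> U \<and> (\<forall>f. f holomorphic_on U \<longrightarrow> contour_integral h f = contour_integral \<gamma> f)"
  \<comment> \<open>Nearness is available for a pair of loops close to \<gamma>; taking one of them
    to be \<gamma> itself compares h with \<gamma> directly.\<close>
  proof -
    obtain \<delta> where "\<delta> > 0" and \<delta>: "\<And>g h. valid_path g \<and> valid_path h \<and>
          (\<forall>t\<in>{0..1}. cmod (g t - \<gamma> t) < \<delta> \<and> cmod (h t - \<gamma> t) < \<delta>) \<and>
          pathfinish g = pathstart g \<and> pathfinish h = pathstart h \<Longrightarrow>
          path_image g \<subseteq> U \<and> path_image h \<subseteq> U \<and>
          (\<forall>f. f holomorphic_on U \<longrightarrow> contour_integral h f = contour_integral g f)"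
      using contour_integral_nearby_loops[OF \<open>open U\<close> valid_path_imp_path[OF valid] img] by blast
    show ?thesis
    proof (rule that[OF \<open>\<delta> > 0\<close>])
      fix h assume "valid_path h" "\<forall>t\<in>{0..1}. cmod (h t - \<gamma> t) < \<delta>" "pathfinish h = pathstart h"
      then show "path_image h \<subseteq> U \<and> (\<forall>f. f holomorphic_on U \<longrightarrow> contour_integral h f = contour_integral \<gamma> f)"
        using \<delta>[of \<gamma> h] valid loop \<open>\<delta> > 0\<close> by simp
    qed
  qed
  obtain h where h: "polynomial_function h" "pathstart h = pathstart \<gamma>" "pathfinish h = pathfinish \<gamma>"
    and h_near: "\<And>t. t \<in> {0..1} \<Longrightarrow> cmod (h t - \<gamma> t) < \<delta>"
    using path_approx_polynomial_function[OF valid_path_imp_path[OF valid] \<delta>] by metis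
  have h_valid: "valid_path h" and h_loop: "pathfinish h = pathstart h"
    using h loop by (auto simp: valid_path_polynomial_function)
  note h_U = near[OF h_valid _ h_loop]
  have h_img: "path_image h \<subseteq> U"
    and h_int: "\<And>f. f holomorphic_on U \<Longrightarrow> contour_integral h f = contour_integral \<gamma> f"
    using h_U h_near by auto
  \<comment> \<open>For z outside U the kernel 1 / (w - z) is holomorphic on U, so winding numbers
    are preserved like any other contour integral.\<close>
  have wind_eq: "winding_number h z = winding_number \<gamma> z" if "z \<notin> U" for z
  proof -
    have "(\<lambda>w. 1 / (w - z)) holomorphic_on U"
      using that by (intro holomorphic_intros) auto
    then show ?thesis
      using that img h_img valid h_valid h_int by (subst (1 2) winding_number_valid_path) auto
  qed
  show ?thesis
  proof (rule that[OF h(1)])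
    show "log_contour (Delta u) h"
      unfolding log_contour_def spectrum_Delta
      using h_valid h_loop h_img wind wind_eq by (auto simp: U_def)
  qed (use h_int in \<open>auto simp: U_def\<close>)
qed

text \<open>The global Cauchy formula on the slit plane needs winding number 0 around the slit,
  which \<open>log_contour\<close> demands. The factor is 1 because every symbol value belongs to
  the spectrum.\<close>

lemma log_contour_cauchy:
  assumes slit: "\<And>p. Delta_symbol u p \<notin> \<real>\<^sub>\<le>\<^sub>0" and h: "log_contour (Delta u) h"
  shows "contour_integral h (\<lambda>z. Ln z / (z - Delta_symbol u p)) = 2 * complex_of_real pi * \<i> * Ln (Delta_symbol u p)"
proof -
  have "((\<lambda>z. Ln z / (z - Delta_symbol u p)) has_contour_integral
      2 * pi * \<i> * winding_number h (Delta_symbol u p) * Ln (Delta_symbol u p)) h"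
  proof (rule Cauchy_integral_formula_global[of "- \<real>\<^sub>\<le>\<^sub>0"])
    show "open (- \<real>\<^sub>\<le>\<^sub>0 :: complex set)"
      by (intro open_Compl closed_nonpos_Reals_complex)
    show "Ln holomorphic_on - \<real>\<^sub>\<le>\<^sub>0"
      by (intro holomorphic_intros) auto
  qed (use slit h in \<open>auto simp: log_contour_def spectrum_Delta\<close>)
  moreover have "winding_number h (Delta_symbol u p) = 1"
    using h unfolding log_contour_def spectrum_Delta by blast
  ultimately show ?thesis
    by (auto dest: contour_integral_unique)
qed

text \<open>The resolvent trace averages Cauchy kernels, so exchanging the two integrals leaves
  Cauchy's formula at each torus point. On the polynomial loop the integrand, path derivative
  included, is jointly continuous, and the exchange is legitimate.\<close>

lemma contour_integral_Ln_resolvent_trace: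
  assumes slit: "\<And>p. Delta_symbol u p \<notin> \<real>\<^sub>\<le>\<^sub>0" and \<gamma>: "log_contour (Delta u) \<gamma>"
  shows "contour_integral \<gamma> (\<lambda>z. Ln z * torus_mean (\<lambda>p. 1 / (z - Delta_symbol u p)))
    = 2 * complex_of_real pi * \<i> * torus_mean (\<lambda>p. Ln (Delta_symbol u p))"
proof -
  obtain h where h: "polynomial_function h" "log_contour (Delta u) h"
    and h_int: "\<And>f. f holomorphic_on - \<real>\<^sub>\<le>\<^sub>0 - range (Delta_symbol u) \<Longrightarrow> contour_integral h f = contour_integral \<gamma> f"
    using smooth_log_contour[OF \<gamma>] by metis
  obtain h' where h': "polynomial_function h'" "\<And>x. (h has_vector_derivative h' x) (at x)"
    using has_vector_derivative_polynomial_function[OF h(1)] by metis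
  have vd: "vector_derivative h (at x) = h' x" for x
    by (rule vector_derivative_at[OF h'(2)])
  have h_img: "h x \<notin> \<real>\<^sub>\<le>\<^sub>0" "h x \<noteq> Delta_symbol u p" if "x \<in> {0..1}" for x p
    using h(2) that unfolding log_contour_def spectrum_Delta path_image_def by blast+
  define G where "G x p = Ln (h x) * (1 / (h x - Delta_symbol u p)) * h' x" for x p
  have cont_h: "continuous_on A (\<lambda>x. h (g x))" "continuous_on A (\<lambda>x. h' (g x))"
    if "continuous_on A g" for A :: "(real \<times> real \<times> real) set" and g
    using continuous_on_polymonial_function[OF h(1)] continuous_on_polymonial_function[OF h'(1)] that
    by (auto intro: continuous_on_compose2[of UNIV])
  have cont_G: "continuous_on ({0..1} \<times> torus) (\<lambda>(x, p). G x p)"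
    unfolding G_def case_prod_unfold
    by (intro continuous_intros cont_h)
      (use h_img in auto)
  have "contour_integral \<gamma> (\<lambda>z. Ln z * torus_mean (\<lambda>p. 1 / (z - Delta_symbol u p)))
      = contour_integral h (\<lambda>z. Ln z * torus_mean (\<lambda>p. 1 / (z - Delta_symbol u p)))"
    by (intro h_int[symmetric] holomorphic_intros holomorphic_on_subset[OF holomorphic_resolvent_trace]) auto
  also have "\<dots> = integral {0..1} (\<lambda>x. Ln (h x) * torus_mean (\<lambda>p. 1 / (h x - Delta_symbol u p)) * h' x)"
    by (simp add: contour_integral_integral vd)
  also have "\<dots> = 1 / (2 * complex_of_real pi)\<^sup>2 * integral {0..1} (\<lambda>x. integral torus (G x))"
  proof -
    have "Ln (h x) * torus_mean (\<lambda>p. 1 / (h x - Delta_symbol u p)) * h' x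
        = 1 / (2 * complex_of_real pi)\<^sup>2 * integral torus (G x)" for x
      unfolding G_def torus_mean_def integral_mult_left integral_mult_right by (simp only: mult_ac)
    then show ?thesis
      by simp
  qed
  also have "integral {0..1} (\<lambda>x. integral torus (G x)) = integral torus (\<lambda>p. integral {0..1} (\<lambda>x. G x p))"
    using integral_swap_continuous[of "0::real" "(0, 0)" 1 "(2 * pi, 2 * pi)" G] cont_G
    by (simp add: torus_def cbox_Pair_eq)
  also have "(\<lambda>p. integral {0..1} (\<lambda>x. G x p)) = (\<lambda>p. 2 * complex_of_real pi * \<i> * Ln (Delta_symbol u p))"
    using log_contour_cauchy[OF slit h(2)] by (simp add: G_def contour_integral_integral vd)
  finally show ?thesis
    by (simp add: torus_mean_def)
qed

lemma Tr_Log_Delta: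
  assumes slit: "\<And>p. Delta_symbol u p \<notin> \<real>\<^sub>\<le>\<^sub>0"
  shows "Tr_vN (Log_op (Delta u)) = torus_mean (\<lambda>p. Ln (Delta_symbol u p))"
proof -
  define \<gamma> where "\<gamma> = (SOME \<gamma>. log_contour (Delta u) \<gamma>)"
  have \<gamma>: "log_contour (Delta u) \<gamma>"
    unfolding \<gamma>_def using log_contour_Delta_exists[OF slit] by (rule someI_ex)
  have "contour_integral \<gamma> (\<lambda>z. Ln z * resolvent_l2 (Delta u) z delta_id 0) =
      contour_integral \<gamma> (\<lambda>z. Ln z * torus_mean (\<lambda>p. 1 / (z - Delta_symbol u p)))"
  proof (rule contour_integral_eq)
    fix z assume "z \<in> path_image \<gamma>"
    then have "z \<notin> range (Delta_symbol u)"
      using \<gamma> by (auto simp: log_contour_def spectrum_Delta)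
    then show "Ln z * resolvent_l2 (Delta u) z delta_id 0 = Ln z * torus_mean (\<lambda>p. 1 / (z - Delta_symbol u p))"
      by (simp add: resolvent_Delta_trace)
  qed
  then show ?thesis
    unfolding Tr_vN_def Log_op_def \<gamma>_def[symmetric]
    by (simp add: contour_integral_Ln_resolvent_trace[OF slit \<gamma>])
qed

lemma torus_mean_of_real_Im:
  assumes "continuous_on torus F"
  shows "torus_mean (\<lambda>p. complex_of_real (Im (F p))) = complex_of_real (Im (torus_mean F))"
proof -
  have "bounded_linear (\<lambda>z. complex_of_real (Im z))"
    by (intro bounded_linear_compose[OF bounded_linear_of_real bounded_linear_Im])
  from integral_linear[OF integrable_on_torus[OF assms] this]
  have *: "integral torus (\<lambda>p. complex_of_real (Im (F p))) = complex_of_real (Im (integral torus F))"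
    by (simp add: o_def)
  have mean: "torus_mean G = (1 / (2 * pi)\<^sup>2) *\<^sub>R integral torus G" for G
    by (simp add: torus_mean_def scaleR_conv_of_real)
  show ?thesis
    unfolding mean * by (simp add: scaleR_conv_of_real)
qed

text \<open>\<open>Ln\<close> undoes \<open>exp\<close> only in the principal strip. The imaginary
  part of the mean is bounded by the largest |Im Ln| on the compact torus; this maximum is attained
  at some q, hence is strictly below pi.\<close>

lemma log_det_Delta_eq:
  assumes slit: "\<And>p. Delta_symbol u p \<notin> \<real>\<^sub>\<le>\<^sub>0"
  shows "log_det_Delta u = torus_mean (\<lambda>p. Ln (Delta_symbol u p))"
proof -
  have cont: "continuous_on torus (\<lambda>p. Ln (Delta_symbol u p))"
    using slit by (intro continuous_intros) auto
  have "(0, 0) \<in> torus"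
    by (simp add: torus_def cbox_Pair_eq)
  then have "\<exists>q\<in>torus. \<forall>p\<in>torus. \<bar>Im (Ln (Delta_symbol u p))\<bar> \<le> \<bar>Im (Ln (Delta_symbol u q))\<bar>"
    by (intro continuous_attains_sup compact_torus continuous_intros cont) auto
  then obtain q where q: "\<And>p. p \<in> torus \<Longrightarrow> \<bar>Im (Ln (Delta_symbol u p))\<bar> \<le> \<bar>Im (Ln (Delta_symbol u q))\<bar>"
    by blast
  have "\<bar>Im (torus_mean (\<lambda>p. Ln (Delta_symbol u p)))\<bar> = cmod (torus_mean (\<lambda>p. complex_of_real (Im (Ln (Delta_symbol u p)))))"
    by (simp add: torus_mean_of_real_Im[OF cont])
  also have "\<dots> \<le> \<bar>Im (Ln (Delta_symbol u q))\<bar>"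
    using q by (intro torus_mean_bound continuous_intros cont) auto
  also have "\<dots> < pi"
  proof -
    have "Delta_symbol u q \<noteq> 0"
      using slit[of q] by auto
    then show ?thesis
      using mpi_less_Im_Ln[of "Delta_symbol u q"] Im_Ln_less_pi[OF slit[of q]] by linarith
  qed
  finally show ?thesis
    unfolding log_det_Delta_def det_vN_def Tr_Log_Delta[OF slit] by (intro Ln_exp) auto
qed

section \<open>The domain and the elliptic integral\<close>

lemma closed_cut_set: "closed cut_set"
proof -
  have "compact (complex_of_real ` {a..b})" for a b
    by (intro compact_continuous_image continuous_intros compact_Icc)
  moreover have "closed {u::complex. cmod u = 1 / sqrt 3}"
    by (intro closed_Collect_eq continuous_intros)
  ultimately show ?thesis
    unfolding cut_set_def by (intro closed_Un) (auto intro: compact_imp_closed)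
qed

lemma open_Omega: "open Omega"
  unfolding Omega_def by (intro open_connected_component open_Compl closed_cut_set)

lemma Omega_disjoint_cut_set: "u \<in> Omega \<Longrightarrow> u \<notin> cut_set"
  using connected_component_subset[of "- cut_set" 0] unfolding Omega_def by blast

text \<open>The moduli of points of \<open>Omega\<close> form a connected set that contains 0 and
  avoids 1/sqrt 3, since the whole circle is cut out.\<close>

lemma Omega_norm_less:
  assumes "u \<in> Omega"
  shows "cmod u < 1 / sqrt 3"
proof (rule ccontr)
  assume "\<not> cmod u < 1 / sqrt 3"
  moreover have "connected (cmod ` Omega)"
    unfolding Omega_def by (intro connected_continuous_image continuous_intros connected_connected_component)
  moreover have "0 \<in> Omega"
  proof -
    have "0 \<notin> cut_set"
      by (auto simp: cut_set_def)
    then show ?thesis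
      by (simp add: Omega_def)
  qed
  then have "0 \<in> cmod ` Omega"
    by (auto intro!: image_eqI[of _ _ 0])
  moreover have "cmod u \<in> cmod ` Omega"
    using assms by blast
  ultimately have "1 / sqrt 3 \<in> cmod ` Omega"
    unfolding connected_iff_interval by (meson less_imp_le not_le order.refl zero_le_divide_1_iff real_sqrt_ge_zero zero_le_numeral)
  then obtain v where "v \<in> Omega" "cmod v = 1 / sqrt 3"
    by auto
  then show False
    using Omega_disjoint_cut_set[of v] by (simp add: cut_set_def)
qed

text \<open>With u = a + i b and x the sum of the doubled cosines, the imaginary part b (6 a - x)
  must vanish. If b = 0, the real part forces (3|a| - 1)(|a| - 1) <= 0, the two real cuts. If x = 6
  a, the real part is 1 - 3|u|^2, and its sign contradicts the bound on |u|.\<close>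

lemma Delta_symbol_not_nonpos:
  assumes u: "u \<in> Omega"
  shows "Delta_symbol u p \<notin> \<real>\<^sub>\<le>\<^sub>0"
proof
  assume np: "Delta_symbol u p \<in> \<real>\<^sub>\<le>\<^sub>0"
  define x where "x = 2 * cos (fst p) + 2 * cos (snd p)"
  define a where "a = Re u"
  define b where "b = Im u"
  have x: "\<bar>x\<bar> \<le> 4"
    using abs_cos_le_one[of "fst p"] abs_cos_le_one[of "snd p"] unfolding x_def
    by (simp del: abs_cos_le_one)
  have sym: "Delta_symbol u p = 1 + 3 * u\<^sup>2 - u * complex_of_real x"
    by (simp add: grid_symbol_def x_def)
  have Re: "1 + 3 * (a * a - b * b) - a * x \<le> 0" and Im: "b * (6 * a - x) = 0"
    using np unfolding sym complex_nonpos_Reals_iff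
    by (auto simp: power2_eq_square a_def b_def algebra_simps)
  show False
  proof (cases "b = 0")
    case True
    have "a * x \<le> \<bar>a\<bar> * 4"
      using mult_left_mono[OF x, of "\<bar>a\<bar>"] abs_ge_self[of "a * x"] by (simp add: abs_mult)
    then have "1 + 3 * (\<bar>a\<bar> * \<bar>a\<bar>) - 4 * \<bar>a\<bar> \<le> 0"
      using Re True by simp
    then have prod: "(3 * \<bar>a\<bar> - 1) * (\<bar>a\<bar> - 1) \<le> 0"
      by (simp add: algebra_simps)
    have "1 / 3 \<le> \<bar>a\<bar> \<and> \<bar>a\<bar> \<le> 1"
      using prod unfolding mult_le_0_iff by linarith
    then have "a \<in> {- 1..- 1 / 3} \<union> {1 / 3..1}"
      by (auto simp: abs_if split: if_splits)
    moreover have "u = complex_of_real a"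
      using True by (simp add: a_def b_def complex_eq_iff)
    ultimately show False
      using Omega_disjoint_cut_set[OF u] by (auto simp: cut_set_def)
  next
    case False
    then have "x = 6 * a"
      using Im by simp
    then have "1 \<le> 3 * (a\<^sup>2 + b\<^sup>2)"
      using Re by (simp add: power2_eq_square)
    also have "a\<^sup>2 + b\<^sup>2 = (cmod u)\<^sup>2"
      by (simp add: a_def b_def cmod_power2)
    also have "(cmod u)\<^sup>2 < (1 / sqrt 3)\<^sup>2"
      using Omega_norm_less[OF u] by (intro power_strict_mono) auto
    finally show False
      by (simp add: power_divide)
  qed
qed

section \<open>The torus mean of the reciprocal symbol as an elliptic integral\<close>

lemma integral_periodic_shift:
  fixes g :: "real \<Rightarrow> complex"
  assumes cont: "continuous_on UNIV g" and per: "\<And>x. g (x + 2 * pi) = g x" and c: "0 \<le> c" "c \<le> 2 * pi"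
  shows "integral {0..2 * pi} (\<lambda>x. g (x + c)) = integral {0..2 * pi} g"
proof -
  have cont': "continuous_on A g" for A
    by (rule continuous_on_subset[OF cont]) auto
  have int: "g integrable_on {a..b}" for a b
    by (rule integrable_continuous_real[OF cont'])
  have "integral {0..2 * pi} (\<lambda>x. g (x + c)) = integral {c..2 * pi + c} g"
    using integral_shift[of 0 c "2 * pi" g] cont' by (simp add: o_def)
  also have "\<dots> = integral {c..2 * pi} g + integral {2 * pi..2 * pi + c} g"
    using c int by (intro Henstock_Kurzweil_Integration.integral_combine[symmetric]) auto
  also have "integral {2 * pi..2 * pi + c} g = integral {0..c} g"
    using integral_shift[of 0 "2 * pi" c g] cont' by (simp add: o_def per add.commute)
  also have "integral {c..2 * pi} g + integral {0..c} g = integral {0..2 * pi} g"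
    using c int by (subst add.commute) (intro Henstock_Kurzweil_Integration.integral_combine, auto)
  finally show ?thesis .
qed

text \<open>The substitution y = t/2 contributes a factor 2 and leaves the interval from 0 to pi.
  Its two halves each give one copy of K, by a quarter-period shift and by the reflection y to pi/2
  - y.\<close>

lemma integral_cos_half_angle_elliptic_K:
  assumes np: "\<And>y. 1 - k\<^sup>2 * (complex_of_real (cos y))\<^sup>2 \<notin> \<real>\<^sub>\<le>\<^sub>0"
  shows "integral {0..2 * pi} (\<lambda>t. 1 / csqrt (1 - k\<^sup>2 * (complex_of_real (cos (t / 2)))\<^sup>2)) = 4 * elliptic_K k"
proof -
  define H where "H y = 1 / csqrt (1 - k\<^sup>2 * (complex_of_real (cos y))\<^sup>2)" for y
  have cont: "continuous_on A H" for A
  proof -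
    have "csqrt (1 - k\<^sup>2 * (complex_of_real (cos y))\<^sup>2) \<noteq> 0" for y
      using np[of y] by auto
    moreover have "continuous_on A (\<lambda>y. csqrt (1 - k\<^sup>2 * (complex_of_real (cos y))\<^sup>2))"
      by (intro continuous_on_compose2[OF continuous_on_csqrt] continuous_intros)
        (use np in \<open>auto simp: complex_nonpos_Reals_iff\<close>)
    ultimately show ?thesis
      unfolding H_def by (intro continuous_intros) auto
  qed
  have int: "H integrable_on {a..b}" for a b
    by (rule integrable_continuous_real[OF cont])
  have K: "elliptic_K k = integral {0..pi / 2} (\<lambda>x. H (pi / 2 - x))"
    by (simp add: elliptic_K_def H_def cos_diff)
  have "((\<lambda>t. (1 / 2) *\<^sub>R H (t / 2)) has_integral integral {0 / 2..2 * pi / 2} H) {0..2 * pi}"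
    by (rule has_integral_substitution[of 0 "2 * pi" "\<lambda>t. t / 2" 0 pi])
      (auto intro!: cont derivative_eq_intros)
  then have "((\<lambda>t. 2 *\<^sub>R (1 / 2) *\<^sub>R H (t / 2)) has_integral 2 *\<^sub>R integral {0 / 2..2 * pi / 2} H) {0..2 * pi}"
    by (rule has_integral_cmul)
  then have "integral {0..2 * pi} (\<lambda>t. H (t / 2)) = 2 * integral {0..pi} H"
    by (simp add: integral_unique scaleR_conv_of_real)
  also have "integral {0..pi} H = integral {0..pi / 2} H + integral {pi / 2..pi} H"
    using int by (intro Henstock_Kurzweil_Integration.integral_combine[symmetric]) auto
  also have "integral {pi / 2..pi} H = elliptic_K k"
    using integral_shift[of 0 "pi / 2" "pi / 2" H] cont
    by (simp add: o_def elliptic_K_def H_def cos_add)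
  also have "integral {0..pi / 2} H = elliptic_K k"
  proof -
    have "integral {0..pi / 2} H = integral {- (pi / 2)..- 0} (\<lambda>x. H (- x))"
      using Henstock_Kurzweil_Integration.integral_reflect_real[of "pi / 2" 0 H] by (rule sym)
    also have "\<dots> = integral {0..pi / 2} ((\<lambda>x. H (- x)) \<circ> (\<lambda>x. x + - (pi / 2)))"
      by (subst integral_shift) (auto intro!: continuous_on_compose2[OF cont] continuous_intros)
    also have "\<dots> = elliptic_K k"
      unfolding K by (simp add: o_def)
    finally show ?thesis .
  qed
  finally show ?thesis
    by (simp add: H_def)
qed

text \<open>
  The shear \<open>(s, t) \<mapsto> (s, s + t)\<close> of the torus turns \<open>cos s + cos t\<close> into the product
  \<open>2 cos (s + t/2) cos (t/2)\<close>, whose \<open>s\<close>-integral is elementary.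
\<close>

lemma torus_mean_elliptic_K:
  assumes nz: "\<And>s t. 1 - k / 2 * (complex_of_real (cos s) + complex_of_real (cos t)) \<noteq> 0"
  shows "torus_mean (\<lambda>p. 1 / (1 - k / 2 * (complex_of_real (cos (fst p)) + complex_of_real (cos (snd p)))))
    = 2 / complex_of_real pi * elliptic_K k"
proof -
  define F where "F s t = 1 / (1 - k / 2 * (complex_of_real (cos s) + complex_of_real (cos t)))" for s t
  have cont: "continuous_on A (\<lambda>x. F (f x) (g x))"
    if "continuous_on A f" "continuous_on A g" for A :: "'a::t2_space set" and f g
    unfolding F_def using that nz by (intro continuous_intros) auto
  \<comment> \<open>A product of two cosines is half a sum of cosines, so the hypothesis also
    excludes these zeros. With w = k cos y this puts 1 - w^2 off the slit.\<close>
  have nz': "1 - k * complex_of_real (cos y) * complex_of_real (cos x) \<noteq> 0" for x y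
  proof -
    have "2 * (cos y * cos x) = cos (x + y) + cos (x - y)"
      by (simp add: cos_add cos_diff)
    then have *: "complex_of_real (cos (x + y)) + complex_of_real (cos (x - y))
        = 2 * (complex_of_real (cos y) * complex_of_real (cos x))"
      by (metis of_real_add of_real_mult of_real_numeral)
    have "k * complex_of_real (cos y) * complex_of_real (cos x)
        = k / 2 * (complex_of_real (cos (x + y)) + complex_of_real (cos (x - y)))"
      unfolding * by simp
    then show ?thesis
      using nz[of "x + y" "x - y"] by metis
  qed
  have np: "1 - k\<^sup>2 * (complex_of_real (cos y))\<^sup>2 \<notin> \<real>\<^sub>\<le>\<^sub>0" for y
    using one_minus_square_not_nonpos[OF nz'[of y]] by (simp add: power_mult_distrib)
  have inner: "integral {0..2 * pi} (\<lambda>s. F s (t + s)) =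
      2 * complex_of_real pi * (1 / csqrt (1 - k\<^sup>2 * (complex_of_real (cos (t / 2)))\<^sup>2))"
    if "t \<in> {0..2 * pi}" for t
  proof -
    define w where "w = k * complex_of_real (cos (t / 2))"
    have "F s (t + s) = 1 / (1 - w * complex_of_real (cos (s + t / 2)))" for s
    proof -
      have "cos s + cos (t + s) = cos ((s + t / 2) - t / 2) + cos ((s + t / 2) + t / 2)"
        by (simp add: add.commute)
      also have "\<dots> = 2 * (cos (s + t / 2) * cos (t / 2))"
        unfolding cos_add[of "s + t / 2"] cos_diff by simp
      finally have "complex_of_real (cos s) + complex_of_real (cos (t + s))
          = 2 * (complex_of_real (cos (s + t / 2)) * complex_of_real (cos (t / 2)))"
        by (metis of_real_add of_real_mult of_real_numeral)
      then show ?thesis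
        by (simp add: F_def w_def mult_ac)
    qed
    then have "integral {0..2 * pi} (\<lambda>s. F s (t + s)) =
        integral {0..2 * pi} (\<lambda>s. 1 / (1 - w * complex_of_real (cos (s + t / 2))))"
      by simp
    also have "\<dots> = integral {0..2 * pi} (\<lambda>s. 1 / (1 - w * complex_of_real (cos s)))"
      by (rule integral_periodic_shift[where g = "\<lambda>s. 1 / (1 - w * complex_of_real (cos s))"])
        (use that nz'[of "t / 2"] in \<open>auto simp: w_def intro!: continuous_intros\<close>)
    \<comment> \<open>The Fourier coefficient of index 0, where the power of q is 1.\<close>
    also have "\<dots> = 2 * complex_of_real pi * (1 / csqrt (1 - w\<^sup>2))"
      using integral_cos_div_one_minus_cos[of w 0] nz'[of "t / 2"] by (simp add: w_def)
    finally show ?thesis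
      by (simp add: w_def power_mult_distrib)
  qed
  have "torus_mean (\<lambda>p. F (fst p) (snd p)) = 1 / (2 * complex_of_real pi)\<^sup>2 *
      integral {0..2 * pi} (\<lambda>s. integral {0..2 * pi} (\<lambda>t. F s t))"
    by (subst torus_mean_iterated) (auto intro!: cont continuous_intros)
  \<comment> \<open>The shear is carried out line by line: for fixed s the inner integral over a
    full period is shifted by s.\<close>
  also have "integral {0..2 * pi} (\<lambda>s. integral {0..2 * pi} (\<lambda>t. F s t)) =
      integral {0..2 * pi} (\<lambda>s. integral {0..2 * pi} (\<lambda>t. F s (t + s)))"
  proof (rule integral_cong)
    fix s :: real assume "s \<in> {0..2 * pi}"
    then show "integral {0..2 * pi} (\<lambda>t. F s t) = integral {0..2 * pi} (\<lambda>t. F s (t + s))"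
      by (intro integral_periodic_shift[symmetric] cont continuous_intros) (auto simp: F_def)
  qed
  also have "\<dots> = integral {0..2 * pi} (\<lambda>t. integral {0..2 * pi} (\<lambda>s. F s (t + s)))"
    using integral_swap_continuous[of "0::real" "0::real" "2 * pi" "2 * pi" "\<lambda>s t. F s (t + s)"]
    by (simp add: case_prod_unfold cont continuous_intros)
  also have "\<dots> = integral {0..2 * pi} (\<lambda>t. 2 * complex_of_real pi *
      (1 / csqrt (1 - k\<^sup>2 * (complex_of_real (cos (t / 2)))\<^sup>2)))"
    by (rule integral_cong) (rule inner)
  also have "\<dots> = 2 * complex_of_real pi * (4 * elliptic_K k)"
    unfolding integral_mult_right integral_cos_half_angle_elliptic_K[OF np] ..
  finally show ?thesis
    by (simp add: F_def power2_eq_square)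
qed

section \<open>The derivative of the log determinant\<close>

lemma deriv_modulus_k:
  assumes "1 + 3 * u\<^sup>2 \<noteq> 0"
  shows "deriv modulus_k u = 4 * (1 - 3 * u\<^sup>2) / (1 + 3 * u\<^sup>2)\<^sup>2"
proof -
  have "((\<lambda>u. 4 * u / (1 + 3 * u\<^sup>2)) has_field_derivative
      (4 * (1 + 3 * u\<^sup>2) - 4 * u * (3 * (2 * u))) / ((1 + 3 * u\<^sup>2) * (1 + 3 * u\<^sup>2))) (at u)"
    using assms by (auto intro!: derivative_eq_intros)
  then have "deriv modulus_k u = (4 * (1 + 3 * u\<^sup>2) - 4 * u * (3 * (2 * u))) / ((1 + 3 * u\<^sup>2) * (1 + 3 * u\<^sup>2))"
    unfolding modulus_k_def[abs_def] by (rule DERIV_imp_deriv)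
  then show ?thesis
    by (simp add: power2_eq_square algebra_simps)
qed

text \<open>The log determinant is known to be the torus mean only on \<open>Omega\<close>; as
  \<open>Omega\<close> is open, this suffices to transfer the derivative obtained under the integral
  sign.\<close>

lemma log_det_Delta_has_field_derivative:
  assumes u: "u \<in> Omega"
  shows "(log_det_Delta has_field_derivative
    torus_mean (\<lambda>p. (6 * u - (2 * complex_of_real (cos (fst p)) + 2 * complex_of_real (cos (snd p)))) / Delta_symbol u p)) (at u)"
proof (rule has_field_derivative_transform_within_open[OF _ open_Omega u])
  note slit = Delta_symbol_not_nonpos
  have nz: "Delta_symbol u p \<noteq> 0" if "u \<in> Omega" for u p
    using slit[OF that, of p] by auto
  show "((\<lambda>u. torus_mean (\<lambda>p. Ln (Delta_symbol u p))) has_field_derivative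
    torus_mean (\<lambda>p. (6 * u - (2 * complex_of_real (cos (fst p)) + 2 * complex_of_real (cos (snd p)))) / Delta_symbol u p)) (at u)"
  proof (rule torus_mean_has_field_derivative[OF open_Omega u])
    fix u p assume u: "u \<in> Omega"
    have "((\<lambda>u. Delta_symbol u p) has_field_derivative
        6 * u - (2 * complex_of_real (cos (fst p)) + 2 * complex_of_real (cos (snd p)))) (at u)"
      unfolding grid_symbol_def by (auto intro!: derivative_eq_intros)
    then show "((\<lambda>u. Ln (Delta_symbol u p)) has_field_derivative
        (6 * u - (2 * complex_of_real (cos (fst p)) + 2 * complex_of_real (cos (snd p)))) / Delta_symbol u p) (at u)"
      using slit[OF u, of p] by (auto intro!: derivative_eq_intros simp: divide_inverse mult.commute)
  next
    fix u assume "u \<in> Omega"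
    then show "continuous_on torus (\<lambda>p. Ln (Delta_symbol u p))"
      using slit by (intro continuous_intros) auto
  next
    show "continuous_on (Omega \<times> torus) (\<lambda>(u, p).
        (6 * u - (2 * complex_of_real (cos (fst p)) + 2 * complex_of_real (cos (snd p)))) / Delta_symbol u p)"
      unfolding case_prod_unfold by (intro continuous_intros) (use nz in auto)
  qed
  show "torus_mean (\<lambda>p. Ln (Delta_symbol v p)) = log_det_Delta v" if "v \<in> Omega" for v
    using log_det_Delta_eq[OF slit[OF that]] by simp
qed

lemma log_det_Delta_derivative_elliptic_K:
  assumes u: "u \<in> Omega" "u \<noteq> 0"
  shows "(log_det_Delta has_field_derivative
    1 / u - 2 / complex_of_real pi * elliptic_K (modulus_k u) * (1 / modulus_k u) * deriv modulus_k u) (at u)"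
proof -
  define k where "k = modulus_k u"
  define \<alpha> where "\<alpha> = 1 + 3 * u\<^sup>2"
  have nz: "Delta_symbol u p \<noteq> 0" for p
    using Delta_symbol_not_nonpos[OF u(1), of p] by auto
  \<comment> \<open>At (pi/2, pi/2) both cosines vanish and the symbol equals \<alpha>.\<close>
  have \<alpha>: "\<alpha> \<noteq> 0"
    using nz[of "(pi / 2, pi / 2)"] by (simp add: grid_symbol_def \<alpha>_def)
  have sym: "Delta_symbol u p = \<alpha> * (1 - k / 2 * (complex_of_real (cos (fst p)) + complex_of_real (cos (snd p))))" for p
    using \<alpha> by (simp add: grid_symbol_def k_def modulus_k_def \<alpha>_def[symmetric] field_simps)
  have knz: "1 - k / 2 * (complex_of_real (cos s) + complex_of_real (cos t)) \<noteq> 0" for s t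
    using nz[of "(s, t)"] by (auto simp: sym)
  have cont: "continuous_on torus (\<lambda>p. 1 / Delta_symbol u p)"
    using nz by (intro continuous_intros) auto
  have M: "torus_mean (\<lambda>p. 1 / Delta_symbol u p) = 2 / complex_of_real pi * elliptic_K k / \<alpha>"
  proof -
    have "torus_mean (\<lambda>p. 1 / Delta_symbol u p) =
        torus_mean (\<lambda>p. 1 / (1 - k / 2 * (complex_of_real (cos (fst p)) + complex_of_real (cos (snd p)))) / \<alpha>)"
      by (simp add: sym mult.commute)
    also have "\<dots> = 2 / complex_of_real pi * elliptic_K k / \<alpha>"
      unfolding torus_mean_divide torus_mean_elliptic_K[OF knz] ..
    finally show ?thesis .
  qed
  have "(6 * u - (2 * complex_of_real (cos (fst p)) + 2 * complex_of_real (cos (snd p)))) / Delta_symbol u p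
      = 1 / u - (1 - 3 * u\<^sup>2) / u * (1 / Delta_symbol u p)" for p
  proof -
    \<comment> \<open>Multiplying the u-derivative of the symbol by u recovers the cosine term of
      the symbol, so the cosines are eliminated and only the reciprocal symbol has to be averaged.
      Dividing back by u is where u must be nonzero.\<close>
    have "u * (6 * u - (2 * complex_of_real (cos (fst p)) + 2 * complex_of_real (cos (snd p))))
        = Delta_symbol u p - (1 - 3 * u\<^sup>2)"
      by (simp add: grid_symbol_def power2_eq_square algebra_simps)
    then have eq: "6 * u - (2 * complex_of_real (cos (fst p)) + 2 * complex_of_real (cos (snd p)))
        = (Delta_symbol u p - (1 - 3 * u\<^sup>2)) / u"
      using u by (metis nonzero_mult_div_cancel_left)
    show ?thesis
      unfolding eq using nz[of p] u by (simp add: field_simps)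
  qed
  then have "torus_mean (\<lambda>p. (6 * u - (2 * complex_of_real (cos (fst p)) + 2 * complex_of_real (cos (snd p)))) / Delta_symbol u p)
      = torus_mean (\<lambda>p. 1 / u - (1 - 3 * u\<^sup>2) / u * (1 / Delta_symbol u p))"
    by simp
  also have "\<dots> = 1 / u - (1 - 3 * u\<^sup>2) / u * (2 / complex_of_real pi * elliptic_K k / \<alpha>)"
    unfolding torus_mean_diff[OF continuous_on_const continuous_on_mult[OF continuous_on_const cont]]
      torus_mean_const torus_mean_cmult M ..
  also have "\<dots> = 1 / u - 2 / complex_of_real pi * elliptic_K k * (1 / k) * deriv modulus_k u"
  proof -
    \<comment> \<open>The logarithmic derivative of k is (1 - 3 u^2) / (u (1 + 3 u^2)), precisely
      the coefficient of K left by the torus mean.\<close>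
    have "1 / (4 * u / \<alpha>) * (4 * x / \<alpha>\<^sup>2) = x / u / \<alpha>" for x
      using u(2) \<alpha> by (simp add: power2_eq_square)
    then have eq: "1 / k * deriv modulus_k u = (1 - 3 * u\<^sup>2) / u / \<alpha>"
      unfolding k_def modulus_k_def deriv_modulus_k[OF \<alpha>[unfolded \<alpha>_def]] \<alpha>_def .
    show ?thesis
      unfolding mult.assoc eq by (simp add: mult_ac)
  qed
  finally show ?thesis
    using log_det_Delta_has_field_derivative[OF u(1)] by (simp add: k_def)
qed

theorem theorem1:
  shows "(\<forall>u\<in>Omega. \<forall>s t :: real.
      1 + 3 * u\<^sup>2 - 2 * u * complex_of_real (cos t) - 2 * u * complex_of_real (cos s) \<notin> \<real>\<^sub>\<le>\<^sub>0) \<and>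
    (\<forall>u\<in>Omega. log_det_Delta u =
      1 / (2 * complex_of_real pi)\<^sup>2 *
        integral {0..2 * pi} (\<lambda>t. integral {0..2 * pi} (\<lambda>s.
          Ln (1 + 3 * u\<^sup>2 - 2 * u * complex_of_real (cos t) - 2 * u * complex_of_real (cos s))))) \<and>
    log_det_Delta analytic_on Omega \<and>
    (\<forall>u\<in>Omega - {0}.
      (log_det_Delta has_field_derivative
        1 / u - 2 / complex_of_real pi * elliptic_K (modulus_k u) *
          (1 / modulus_k u) * deriv modulus_k u) (at u))"
proof (intro conjI ballI allI)
  \<comment> \<open>The torus point is (t, s), so that the outer variable of the iterated integral
    is t as in the claim.\<close>
  have sym: "1 + 3 * u\<^sup>2 - 2 * u * complex_of_real (cos t) - 2 * u * complex_of_real (cos s) = Delta_symbol u (t, s)" for u s t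
    by (simp add: grid_symbol_def algebra_simps)
  show "1 + 3 * u\<^sup>2 - 2 * u * complex_of_real (cos t) - 2 * u * complex_of_real (cos s) \<notin> \<real>\<^sub>\<le>\<^sub>0"
    if "u \<in> Omega" for u s t
    unfolding sym by (rule Delta_symbol_not_nonpos[OF that])
  show "log_det_Delta u = 1 / (2 * complex_of_real pi)\<^sup>2 *
        integral {0..2 * pi} (\<lambda>t. integral {0..2 * pi} (\<lambda>s.
          Ln (1 + 3 * u\<^sup>2 - 2 * u * complex_of_real (cos t) - 2 * u * complex_of_real (cos s))))"
    if "u \<in> Omega" for u
  proof -
    note slit = Delta_symbol_not_nonpos[OF that]
    have "continuous_on torus (\<lambda>p. Ln (Delta_symbol u p))"
      using slit by (intro continuous_intros) auto
    from torus_mean_iterated[OF this] show ?thesis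
      unfolding sym log_det_Delta_eq[OF slit] .
  qed
  show "log_det_Delta analytic_on Omega"
    using log_det_Delta_has_field_derivative
    by (auto simp: analytic_on_open[OF open_Omega] holomorphic_on_open[OF open_Omega])
  show "(log_det_Delta has_field_derivative
        1 / u - 2 / complex_of_real pi * elliptic_K (modulus_k u) *
          (1 / modulus_k u) * deriv modulus_k u) (at u)" if "u \<in> Omega - {0}" for u
    using log_det_Delta_derivative_elliptic_K[of u] that by blast
qed

end
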